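(* Let $k$ be a field, $\alpha,\beta\in\mathcal A$. The pair $(\chi(\mathfrak a),\eta(\mathfrak a))$ completely determines a double coset $\mathfrak a\in Q_\alpha\backslash\mathrm{GL}(2\infty,k)/Q_\beta$; that is, if $\mathfrak a,\mathfrak a'\in Q_\alpha\backslash\mathrm{GL}(2\infty,k)/Q_\beta$ satisfy $\chi(\mathfrak a)=\chi(\mathfrak a')$ and $\eta(\mathfrak a)=\eta(\mathfrak a')$, then $\mathfrak a=\mathfrak a'$.
   Context: $\mathrm{GL}(2\infty,k)$ is the group of invertible two-sided infinite matrices $g=(g_{ij})_{i,j\in\mathbb Z}$ over $k$ such that $g-1$ has only finitely many nonzero entries; it acts on the space $k^{2\infty}$ of finitely supported columns $(v_j)_{j\in\mathbb Z}$. $\mathcal A$ is the set of pairs $\alpha=(\alpha_-,\alpha_+)$ of integers with $\alpha_-\le\alpha_+$. For $\alpha\in\mathcal A$ decompose $k^{2\infty}=k_\alpha^-\oplus k_\alpha\oplus k_\alpha^+$, the summands consisting of sequences supported on $j\le\alpha_-$, on $\alpha_-<j\le\alpha_+$, and on $j>\alpha_+$. $Q_\alpha$ is the subgroup of matrices having in this decomposition the block form $\begin{pmatrix} * & * & * \\ 0 & 1 & * \\ 0 & 0 & * \end{pmatrix}$. A linear relation $P:V\rightrightarrows W$ is a linear subspace of $V\oplus W$. For $A\in\mathrm{GL}(2\infty,k)$ write $A=(a_{ij})_{1\le i,j\le 3}$ in block form, rows being split according to $k^-_\alpha\oplus k_\alpha\oplus k^+_\alpha$ and columns according to $k^-_\beta\oplus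 k_\beta\oplus k^+_\beta$. The characteristic linear relation $\chi(A):k_\beta\rightrightarrows k_\alpha$ is the set of all $(v,u)\in k_\beta\oplus k_\alpha$ for which there exist $x\in k_\alpha^-$, $y\in k_\beta^-$ with $\begin{pmatrix} x \\ u \\ 0 \end{pmatrix}=A\begin{pmatrix} y \\ v \\ 0 \end{pmatrix}$. It depends only on the double coset $\mathfrak a=Q_\alpha A Q_\beta$ and is denoted $\chi(\mathfrak a)$. Also $\eta(\mathfrak a):=\operatorname{rk}a_{31}$ (a finite number depending only on $\mathfrak a$). *)

theory Defs
  imports
    Complex_Main
    "HOL-Library.Groups_Big_Fun"
    "HOL-Library.Function_Algebras"
    "HOL-Algebra.Coset"
begin

text \<open>Two-sided infinite matrices are functions \<open>int \<Rightarrow> int \<Rightarrow> 'k\<close> (row index first), columns are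
  functions \<open>int \<Rightarrow> 'k\<close>.  \<^const>\<open>Sum_any\<close> is the sum of the nonzero terms; below it is only
  relevant where there are finitely many of them.\<close>

definition mat_one :: "int \<Rightarrow> int \<Rightarrow> 'k::field"
  where "mat_one i j = (if i = j then 1 else 0)"

definition mat_mult :: "(int \<Rightarrow> int \<Rightarrow> 'k::field) \<Rightarrow> (int \<Rightarrow> int \<Rightarrow> 'k) \<Rightarrow> int \<Rightarrow> int \<Rightarrow> 'k"
  where "mat_mult g h i j = Sum_any (\<lambda>l. g i l * h l j)"

definition mat_vec :: "(int \<Rightarrow> int \<Rightarrow> 'k::field) \<Rightarrow> (int \<Rightarrow> 'k) \<Rightarrow> int \<Rightarrow> 'k"
  where "mat_vec g v i = Sum_any (\<lambda>l. g i l * v l)"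

text \<open>The inverse \<open>h\<close> is an arbitrary matrix; it automatically differs from \<^const>\<open>mat_one\<close> in
  finitely many entries only, see \<open>window_inverse\<close>.\<close>

definition GL2inf :: "(int \<Rightarrow> int \<Rightarrow> 'k::field) monoid"
  where "GL2inf =
    \<lparr>carrier = {g. finite {(i, j). g i j \<noteq> mat_one i j} \<and>
                   (\<exists>h. mat_mult g h = mat_one \<and> mat_mult h g = mat_one)},
     mult = mat_mult, one = mat_one\<rparr>"

definition index_pairs :: "(int \<times> int) set"
  where "index_pairs = {\<alpha>. fst \<alpha> \<le> snd \<alpha>}"

definition fin_columns :: "(int \<Rightarrow> 'k::field) set"
  where "fin_columns = {v. finite {j. v j \<noteq> 0}}"

definition minus_idx :: "int \<times> int \<Rightarrow> int set"
  where "minus_idx \<alpha> = {j. j \<le> fst \<alpha>}"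

definition mid_idx :: "int \<times> int \<Rightarrow> int set"
  where "mid_idx \<alpha> = {j. fst \<alpha> < j \<and> j \<le> snd \<alpha>}"

definition plus_idx :: "int \<times> int \<Rightarrow> int set"
  where "plus_idx \<alpha> = {j. snd \<alpha> < j}"

definition supported_on :: "int set \<Rightarrow> (int \<Rightarrow> 'k::field) set"
  where "supported_on J = {v \<in> fin_columns. \<forall>j. v j \<noteq> 0 \<longrightarrow> j \<in> J}"

definition Q :: "int \<times> int \<Rightarrow> (int \<Rightarrow> int \<Rightarrow> 'k::field) set"
  where "Q \<alpha> = {g \<in> carrier GL2inf.
      (\<forall>i \<in> mid_idx \<alpha>. \<forall>j \<in> minus_idx \<alpha>. g i j = 0) \<and>
      (\<forall>i \<in> plus_idx \<alpha>. \<forall>j \<in> minus_idx \<alpha>. g i j = 0) \<and>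
      (\<forall>i \<in> mid_idx \<alpha>. \<forall>j \<in> mid_idx \<alpha>. g i j = mat_one i j) \<and>
      (\<forall>i \<in> plus_idx \<alpha>. \<forall>j \<in> mid_idx \<alpha>. g i j = 0)}"

definition double_coset ::
    "int \<times> int \<Rightarrow> int \<times> int \<Rightarrow> (int \<Rightarrow> int \<Rightarrow> 'k::field) \<Rightarrow> (int \<Rightarrow> int \<Rightarrow> 'k) set"
  where "double_coset \<alpha> \<beta> A = Q \<alpha> <#>\<^bsub>GL2inf\<^esub> (A <#\<^bsub>GL2inf\<^esub> Q \<beta>)"

definition double_cosets :: "int \<times> int \<Rightarrow> int \<times> int \<Rightarrow> (int \<Rightarrow> int \<Rightarrow> 'k::field) set set"
  where "double_cosets \<alpha> \<beta> = double_coset \<alpha> \<beta> ` carrier GL2inf"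

text \<open>A linear relation between subspaces of the space of columns is a set of pairs of columns.
  The sum \<open>x + u\<close> is the column with blocks \<open>x, u, 0\<close>.\<close>

definition chi :: "int \<times> int \<Rightarrow> int \<times> int \<Rightarrow> (int \<Rightarrow> int \<Rightarrow> 'k::field)
    \<Rightarrow> ((int \<Rightarrow> 'k) \<times> (int \<Rightarrow> 'k)) set"
  where "chi \<alpha> \<beta> A = {(v, u). v \<in> supported_on (mid_idx \<beta>) \<and> u \<in> supported_on (mid_idx \<alpha>) \<and>
      (\<exists>x \<in> supported_on (minus_idx \<alpha>). \<exists>y \<in> supported_on (minus_idx \<beta>).
         x + u = mat_vec A (y + v))}"

definition col_scale :: "'k::field \<Rightarrow> (int \<Rightarrow> 'k) \<Rightarrow> int \<Rightarrow> 'k"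
  where "col_scale c v = (\<lambda>i. c * v i)"

global_interpretation col: vector_space "col_scale :: 'k::field \<Rightarrow> (int \<Rightarrow> 'k) \<Rightarrow> int \<Rightarrow> 'k"
  by unfold_locales (auto simp: col_scale_def fun_eq_iff algebra_simps)

text \<open>The rank of the block with rows \<open>I\<close> and columns \<open>J\<close> is the dimension of its column space;
  the columns of the block are extended by zero outside \<open>I\<close>.\<close>

definition block_rank :: "int set \<Rightarrow> int set \<Rightarrow> (int \<Rightarrow> int \<Rightarrow> 'k::field) \<Rightarrow> nat"
  where "block_rank I J A = col.dim ((\<lambda>j i. if i \<in> I then A i j else 0) ` J)"

definition eta :: "int \<times> int \<Rightarrow> int \<times> int \<Rightarrow> (int \<Rightarrow> int \<Rightarrow> 'k::field) \<Rightarrow> nat"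
  where "eta \<alpha> \<beta> A = block_rank (plus_idx \<alpha>) (minus_idx \<beta>) A"

text \<open>The common values of \<^const>\<open>chi\<close> and \<^const>\<open>eta\<close> on a double coset; that they exist is shown
  in \<open>chi_coset_eq\<close> and \<open>eta_coset_eq\<close> below.\<close>

definition chi_coset :: "int \<times> int \<Rightarrow> int \<times> int \<Rightarrow> (int \<Rightarrow> int \<Rightarrow> 'k::field) set
    \<Rightarrow> ((int \<Rightarrow> 'k) \<times> (int \<Rightarrow> 'k)) set"
  where "chi_coset \<alpha> \<beta> D = (THE R. \<forall>A \<in> D. chi \<alpha> \<beta> A = R)"

definition eta_coset :: "int \<times> int \<Rightarrow> int \<times> int \<Rightarrow> (int \<Rightarrow> int \<Rightarrow> 'k::field) set \<Rightarrow> nat"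
  where "eta_coset \<alpha> \<beta> D = (THE n. \<forall>A \<in> D. eta \<alpha> \<beta> A = n)"


subsection \<open>The group structure\<close>

definition window :: "int \<Rightarrow> (int \<Rightarrow> int \<Rightarrow> 'k::field) \<Rightarrow> bool"
  where "window n g \<longleftrightarrow> (\<forall>i j. \<bar>i\<bar> > n \<or> \<bar>j\<bar> > n \<longrightarrow> g i j = mat_one i j)"

lemma finite_iff_window: "finite {(i, j). g i j \<noteq> mat_one i j} \<longleftrightarrow> (\<exists>n. window n g)"
proof
  assume fin: "finite {(i, j). g i j \<noteq> mat_one i j}" (is "finite ?S")
  let ?T = "insert 0 ((\<lambda>p. \<bar>fst p\<bar>) ` ?S \<union> (\<lambda>p. \<bar>snd p\<bar>) ` ?S)"
  have T: "finite ?T" using fin by simp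
  have "window (Max ?T) g"
    unfolding window_def
  proof (intro allI impI)
    fix i j :: int
    assume *: "\<bar>i\<bar> > Max ?T \<or> \<bar>j\<bar> > Max ?T"
    show "g i j = mat_one i j"
    proof (rule ccontr)
      assume "g i j \<noteq> mat_one i j"
      then have "(i, j) \<in> ?S" by simp
      then have "\<bar>i\<bar> \<in> ?T" "\<bar>j\<bar> \<in> ?T" by force+
      then have "\<bar>i\<bar> \<le> Max ?T" "\<bar>j\<bar> \<le> Max ?T" using T by (auto simp only: Max_ge)
      with * show False by linarith
    qed
  qed
  then show "\<exists>n. window n g" ..
next
  assume "\<exists>n. window n g"
  then obtain n where n: "window n g" ..
  have "\<bar>i\<bar> \<le> n \<and> \<bar>j\<bar> \<le> n" if "g i j \<noteq> mat_one i j" for i j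
    using n that unfolding window_def by (meson not_less)
  then have "{(i, j). g i j \<noteq> mat_one i j} \<subseteq> {-n..n} \<times> {-n..n}"
    by (auto simp: abs_le_iff minus_le_iff)
  then show "finite {(i, j). g i j \<noteq> mat_one i j}"
    using finite_subset by blast
qed

lemma window_mono: "window n g \<Longrightarrow> n \<le> m \<Longrightarrow> window m g"
  unfolding window_def by (meson le_less_trans)

lemma window_row: assumes "window n g" shows "finite {l. g i l \<noteq> 0}"
proof (rule finite_subset)
  have "l \<in> insert i {-n..n}" if "g i l \<noteq> 0" for l
  proof -
    have "\<bar>l\<bar> \<le> n \<or> l = i"
      using assms that unfolding window_def mat_one_def by (metis not_less)
    then show ?thesis by auto
  qed
  then show "{l. g i l \<noteq> 0} \<subseteq> insert i {-n..n}" by blast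
qed simp

lemma window_col: assumes "window n g" shows "finite {l. g l j \<noteq> 0}"
proof (rule finite_subset)
  have "l \<in> insert j {-n..n}" if "g l j \<noteq> 0" for l
  proof -
    have "\<bar>l\<bar> \<le> n \<or> l = j"
      using assms that unfolding window_def mat_one_def by (metis not_less)
    then show ?thesis by auto
  qed
  then show "{l. g l j \<noteq> 0} \<subseteq> insert j {-n..n}" by blast
qed simp

lemma Sum_any_delta_left: "Sum_any (\<lambda>l. mat_one i l * f l) = f i"
proof -
  have *: "(\<lambda>l. mat_one i l * f l) = (\<lambda>l. if l = i then f l else 0)"
    by (auto simp: mat_one_def)
  show ?thesis unfolding * by (rule Sum_any.delta)
qed

lemma Sum_any_delta_right: "Sum_any (\<lambda>l. f l * mat_one l j) = f j"
proof -
  have *: "(\<lambda>l. f l * mat_one l j) = (\<lambda>l. if l = j then f l else 0)"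
    by (auto simp: mat_one_def)
  show ?thesis unfolding * by (rule Sum_any.delta)
qed

lemma mat_mult_row_one: "(\<And>l. g i l = mat_one i l) \<Longrightarrow> mat_mult g h i j = h i j"
  unfolding mat_mult_def by (simp add: Sum_any_delta_left)

lemma mat_mult_col_one: "(\<And>l. h l j = mat_one l j) \<Longrightarrow> mat_mult g h i j = g i j"
  unfolding mat_mult_def by (simp add: Sum_any_delta_right)

lemma window_mult:
  assumes "window n g" "window n h" shows "window n (mat_mult g h)"
  unfolding window_def
proof (intro allI impI)
  fix i j :: int
  assume "\<bar>i\<bar> > n \<or> \<bar>j\<bar> > n"
  then show "mat_mult g h i j = mat_one i j"
  proof
    assume i: "\<bar>i\<bar> > n"
    then have "mat_mult g h i j = h i j"
      using assms(1) by (intro mat_mult_row_one) (simp add: window_def)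
    with i assms(2) show ?thesis by (simp add: window_def)
  next
    assume j: "\<bar>j\<bar> > n"
    then have "mat_mult g h i j = g i j"
      using assms(2) by (intro mat_mult_col_one) (simp add: window_def)
    with j assms(1) show ?thesis by (simp add: window_def)
  qed
qed

lemma window_inverse:
  assumes "window n g" "mat_mult g h = mat_one" "mat_mult h g = mat_one"
  shows "window n h"
  unfolding window_def
proof (intro allI impI)
  fix i j :: int
  assume "\<bar>i\<bar> > n \<or> \<bar>j\<bar> > n"
  then show "h i j = mat_one i j"
  proof
    assume "\<bar>i\<bar> > n"
    then have "mat_mult g h i j = h i j"
      using assms(1) by (intro mat_mult_row_one) (simp add: window_def)
    with assms show ?thesis by simp
  next
    assume "\<bar>j\<bar> > n"
    then have "mat_mult h g i j = h i j"
      using assms(1) by (intro mat_mult_col_one) (simp add: window_def)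
    with assms show ?thesis by simp
  qed
qed

lemma Sum_any_assoc:
  fixes a c :: "int \<Rightarrow> 'k::field"
  assumes a: "finite {m. a m \<noteq> 0}" and c: "finite {l. c l \<noteq> 0}"
    and b: "\<And>l. finite {m. b m l \<noteq> 0}" "\<And>m. finite {l. b m l \<noteq> 0}"
  shows "Sum_any (\<lambda>l. Sum_any (\<lambda>m. a m * b m l) * c l)
       = Sum_any (\<lambda>m. a m * Sum_any (\<lambda>l. b m l * c l))"
proof -
  have fa: "finite {m. a m * b m l \<noteq> 0}" for l
    by (rule finite_subset[OF _ a]) auto
  have fc: "finite {l. b m l * c l \<noteq> 0}" for m
    by (rule finite_subset[OF _ c]) auto
  have "Sum_any (\<lambda>l. Sum_any (\<lambda>m. a m * b m l) * c l)
      = Sum_any (\<lambda>l. Sum_any (\<lambda>m. a m * b m l * c l))"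
    using fa by (simp add: Sum_any_left_distrib)
  also have "\<dots> = Sum_any (\<lambda>m. Sum_any (\<lambda>l. a m * b m l * c l))"
    by (rule Sum_any.swap[where C = "{l. c l \<noteq> 0} \<times> {m. a m \<noteq> 0}"]) (use a c in auto)
  also have "\<dots> = Sum_any (\<lambda>m. a m * Sum_any (\<lambda>l. b m l * c l))"
    using fc by (simp add: Sum_any_right_distrib mult.assoc)
  finally show ?thesis .
qed

lemma mat_mult_assoc:
  assumes "window p a" "window q b" "window r c"
  shows "mat_mult (mat_mult a b) c = mat_mult a (mat_mult b c)"
  by (intro ext, unfold mat_mult_def, rule Sum_any_assoc)
    (use assms window_row window_col in blast)+

lemma mat_vec_mult:
  assumes "window p a" "window q b" "v \<in> fin_columns"
  shows "mat_vec (mat_mult a b) v = mat_vec a (mat_vec b v)"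
  by (intro ext, unfold mat_mult_def mat_vec_def, rule Sum_any_assoc)
    (use assms window_row window_col in \<open>auto simp: fin_columns_def\<close>)

lemma mat_one_mult [simp]: "mat_mult mat_one h = h" "mat_mult h mat_one = h"
  by (auto simp: fun_eq_iff mat_mult_row_one mat_mult_col_one)

lemma mat_vec_one [simp]: "mat_vec mat_one v = v"
  by (simp add: fun_eq_iff mat_vec_def Sum_any_delta_left)

lemma GL2inf_simps [simp]: "mult GL2inf = mat_mult" "one GL2inf = mat_one"
  by (simp_all add: GL2inf_def)

lemma GL2inf_carrier_iff:
  "g \<in> carrier GL2inf \<longleftrightarrow>
    (\<exists>n h. window n g \<and> window n h \<and> mat_mult g h = mat_one \<and> mat_mult h g = mat_one)"
  unfolding GL2inf_def using window_inverse by (force simp: finite_iff_window)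

lemma GL2inf_window: "g \<in> carrier GL2inf \<Longrightarrow> \<exists>n. window n g"
  by (auto simp: GL2inf_carrier_iff)

lemma window_one: "window n mat_one"
  by (simp add: window_def)

lemma group_GL2inf: "group (GL2inf :: (int \<Rightarrow> int \<Rightarrow> 'k::field) monoid)"
proof (rule groupI)
  fix x y :: "int \<Rightarrow> int \<Rightarrow> 'k"
  assume "x \<in> carrier GL2inf" "y \<in> carrier GL2inf"
  then obtain n m x' y' where
    x: "window n x" "window n x'" "mat_mult x x' = mat_one" "mat_mult x' x = mat_one" and
    y: "window m y" "window m y'" "mat_mult y y' = mat_one" "mat_mult y' y = mat_one"
    by (auto simp: GL2inf_carrier_iff)
  define p where "p = max n m"
  have w: "window p x" "window p x'" "window p y" "window p y'"
    using x y by (auto simp: p_def intro: window_mono)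
  note ws = w window_mult[OF w(1) w(3)] window_mult[OF w(4) w(2)]
  have "mat_mult (mat_mult x y) (mat_mult y' x') = mat_mult x (mat_mult (mat_mult y y') x')"
    using ws by (simp add: mat_mult_assoc[where p = p and q = p and r = p])
  moreover have "mat_mult (mat_mult y' x') (mat_mult x y) = mat_mult y' (mat_mult (mat_mult x' x) y)"
    using ws by (simp add: mat_mult_assoc[where p = p and q = p and r = p])
  ultimately show "x \<otimes>\<^bsub>GL2inf\<^esub> y \<in> carrier GL2inf"
    unfolding GL2inf_carrier_iff using ws x y by (auto simp: GL2inf_carrier_iff)
next
  fix x y z :: "int \<Rightarrow> int \<Rightarrow> 'k"
  assume "x \<in> carrier GL2inf" "y \<in> carrier GL2inf" "z \<in> carrier GL2inf"
  then show "x \<otimes>\<^bsub>GL2inf\<^esub> y \<otimes>\<^bsub>GL2inf\<^esub> z = x \<otimes>\<^bsub>GL2inf\<^esub> (y \<otimes>\<^bsub>GL2inf\<^esub> z)"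
    using mat_mult_assoc GL2inf_window by (metis GL2inf_simps(1))
next
  show "\<one>\<^bsub>GL2inf\<^esub> \<in> carrier (GL2inf :: (int \<Rightarrow> int \<Rightarrow> 'k) monoid)"
    by (auto simp: GL2inf_carrier_iff intro: window_one)
next
  fix x :: "int \<Rightarrow> int \<Rightarrow> 'k"
  assume "x \<in> carrier GL2inf"
  then show "\<exists>y \<in> carrier GL2inf. y \<otimes>\<^bsub>GL2inf\<^esub> x = \<one>\<^bsub>GL2inf\<^esub>"
    unfolding GL2inf_carrier_iff Bex_def GL2inf_simps by blast
qed simp


subsection \<open>The subgroups \<open>Q \<alpha>\<close>\<close>

definition cut :: "int \<Rightarrow> (int \<Rightarrow> int \<Rightarrow> 'k::field) \<Rightarrow> bool"
  where "cut c g \<longleftrightarrow> (\<forall>i j. j \<le> c \<and> c < i \<longrightarrow> g i j = 0)"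

lemma Q_iff:
  assumes "\<alpha> \<in> index_pairs"
  shows "g \<in> Q \<alpha> \<longleftrightarrow> g \<in> carrier GL2inf \<and> cut (fst \<alpha>) g \<and> cut (snd \<alpha>) g \<and>
    (\<forall>i \<in> mid_idx \<alpha>. \<forall>j \<in> mid_idx \<alpha>. g i j = mat_one i j)"
proof -
  have "cut (fst \<alpha>) g \<and> cut (snd \<alpha>) g \<longleftrightarrow>
      (\<forall>i \<in> mid_idx \<alpha>. \<forall>j \<in> minus_idx \<alpha>. g i j = 0) \<and>
      (\<forall>i \<in> plus_idx \<alpha>. \<forall>j \<in> minus_idx \<alpha>. g i j = 0) \<and>
      (\<forall>i \<in> plus_idx \<alpha>. \<forall>j \<in> mid_idx \<alpha>. g i j = 0)" (is "?L \<longleftrightarrow> ?R")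
  proof
    assume ?L
    with assms show ?R
      by (auto simp: cut_def minus_idx_def mid_idx_def plus_idx_def index_pairs_def)
  next
    assume R: ?R
    have "g i j = 0" if "j \<le> fst \<alpha>" "fst \<alpha> < i" for i j
      using R that by (cases "i \<le> snd \<alpha>") (auto simp: minus_idx_def mid_idx_def plus_idx_def)
    moreover have "g i j = 0" if "j \<le> snd \<alpha>" "snd \<alpha> < i" for i j
      using R that by (cases "j \<le> fst \<alpha>") (auto simp: minus_idx_def mid_idx_def plus_idx_def)
    ultimately show ?L by (simp add: cut_def)
  qed
  then show ?thesis unfolding Q_def by blast
qed

lemma cut_mult: "cut c g \<Longrightarrow> cut c h \<Longrightarrow> cut c (mat_mult g h)"
proof (unfold cut_def, intro allI impI)
  fix i j
  assume *: "\<forall>i j. j \<le> c \<and> c < i \<longrightarrow> g i j = 0" "\<forall>i j. j \<le> c \<and> c < i \<longrightarrow> h i j = 0" "j \<le> c \<and> c < i"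
  have "g i l * h l j = 0" for l
    using * by (cases "l \<le> c") auto
  then have z: "(\<lambda>l. g i l * h l j) = (\<lambda>l. 0)" by blast
  show "mat_mult g h i j = 0" unfolding mat_mult_def z by simp
qed

lemma mat_vec_add:
  fixes v w :: "int \<Rightarrow> 'k::field"
  assumes "window n g"
  shows "mat_vec g (v + w) = mat_vec g v + mat_vec g w"
proof
  fix i
  have "finite {l. g i l * f l \<noteq> 0}" for f
    by (rule finite_subset[OF _ window_row[OF assms]]) auto
  then show "mat_vec g (v + w) i = (mat_vec g v + mat_vec g w) i"
    by (simp add: mat_vec_def distrib_left Sum_any.distrib)
qed

lemma linear_mat_vec:
  fixes g :: "int \<Rightarrow> int \<Rightarrow> 'k::field"
  assumes "window n g" shows "Vector_Spaces.linear col_scale col_scale (mat_vec g)"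
proof
  fix v w :: "int \<Rightarrow> 'k" and c :: 'k
  show "mat_vec g (v + w) = mat_vec g v + mat_vec g w"
    using assms by (rule mat_vec_add)
  have "mat_vec g (col_scale c v) i = c * mat_vec g v i" for i
  proof -
    have "finite {l. g i l * v l \<noteq> 0}"
      by (rule finite_subset[OF _ window_row[OF assms]]) auto
    then show ?thesis
      by (simp add: mat_vec_def col_scale_def Sum_any_right_distrib algebra_simps)
  qed
  then show "mat_vec g (col_scale c v) = col_scale c (mat_vec g v)"
    by (simp add: fun_eq_iff col_scale_def)
qed

definition unit_col :: "int \<Rightarrow> int \<Rightarrow> 'k::field"
  where "unit_col j = (\<lambda>i. mat_one i j)"

lemma mat_vec_unit_col: "mat_vec g (unit_col j) = (\<lambda>i. g i j)"
  by (simp add: fun_eq_iff mat_vec_def unit_col_def Sum_any_delta_right)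

lemma unit_col_fin: "unit_col j \<in> fin_columns"
  by (simp add: unit_col_def fin_columns_def mat_one_def)

lemma subspace_supported_on: "col.subspace (supported_on J :: (int \<Rightarrow> 'k::field) set)"
proof (rule col.subspaceI)
  fix v w :: "int \<Rightarrow> 'k" and c :: 'k
  assume v: "v \<in> supported_on J"
  have "{j. c * v j \<noteq> 0} \<subseteq> {j. v j \<noteq> 0}" by auto
  with v show "col_scale c v \<in> supported_on J"
    by (auto simp: supported_on_def fin_columns_def col_scale_def intro: finite_subset)
  assume w: "w \<in> supported_on J"
  have "{j. v j + w j \<noteq> 0} \<subseteq> {j. v j \<noteq> 0} \<union> {j. w j \<noteq> 0}" by auto
  with v w show "v + w \<in> supported_on J"
    by (auto simp: supported_on_def fin_columns_def intro: finite_subset) 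
qed (simp add: supported_on_def fin_columns_def)

lemma supported_on_span:
  assumes "v \<in> supported_on J" shows "v \<in> col.span (unit_col ` J)"
proof -
  let ?S = "{j. v j \<noteq> 0}"
  have S: "finite ?S" "?S \<subseteq> J"
    using assms by (auto simp: supported_on_def fin_columns_def)
  have sum_ap: "(\<Sum>j\<in>T. col_scale (v j) (unit_col j)) i = (\<Sum>j\<in>T. v j * unit_col j i)"
    if "finite T" for T i
    using that by (induction T rule: finite_induct) (auto simp: col_scale_def)
  have "v = (\<Sum>j\<in>?S. col_scale (v j) (unit_col j))"
  proof
    fix i
    have "(\<Sum>j\<in>?S. v j * unit_col j i) = (\<Sum>j\<in>?S. if i = j then v j else 0)"
      by (rule sum.cong) (auto simp: unit_col_def mat_one_def)
    also have "\<dots> = v i" using S by (simp add: sum.delta)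
    finally show "v i = (\<Sum>j\<in>?S. col_scale (v j) (unit_col j)) i"
      using S sum_ap by simp
  qed
  also have "\<dots> \<in> col.span (unit_col ` J)"
    using S by (intro col.span_sum col.span_scale col.span_base) auto
  finally show ?thesis .
qed

lemma unit_col_supported_on: "j \<in> J \<Longrightarrow> unit_col j \<in> supported_on J"
  by (simp add: supported_on_def unit_col_fin) (simp add: unit_col_def mat_one_def)

lemma span_unit_col: "col.span (unit_col ` J) = supported_on J"
  using supported_on_span subspace_supported_on unit_col_supported_on
  by (metis (no_types, lifting) col.span_minimal image_subsetI subsetI subset_antisym)

lemma independent_unit_col: "col.independent (unit_col ` J :: (int \<Rightarrow> 'k::field) set)"
proof
  assume "col.dependent (unit_col ` J :: (int \<Rightarrow> 'k) set)"
  then obtain j where j: "j \<in> J" "(unit_col j :: int \<Rightarrow> 'k) \<in> col.span (unit_col ` J - {unit_col j})"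
    unfolding col.dependent_def by blast
  have "unit_col ` J - {unit_col j :: int \<Rightarrow> 'k} \<subseteq> unit_col ` (J - {j})" by auto
  with j have "(unit_col j :: int \<Rightarrow> 'k) \<in> col.span (unit_col ` (J - {j}))"
    using col.span_mono by blast
  then have "(unit_col j :: int \<Rightarrow> 'k) \<in> supported_on (J - {j})"
    by (simp only: span_unit_col)
  then have "(unit_col j :: int \<Rightarrow> 'k) j \<noteq> 0 \<longrightarrow> j \<in> J - {j}"
    unfolding supported_on_def by blast
  then show False by (simp add: unit_col_def mat_one_def)
qed

lemma inj_unit_col: "inj (unit_col :: int \<Rightarrow> int \<Rightarrow> 'k::field)"
proof (rule injI)
  fix i j :: int
  assume "(unit_col i :: int \<Rightarrow> 'k) = unit_col j"
  then have "(unit_col i :: int \<Rightarrow> 'k) i = unit_col j i" by simp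
  then show "i = j" by (auto simp: unit_col_def mat_one_def split: if_splits)
qed

lemma cut_inverse:
  fixes g h :: "int \<Rightarrow> int \<Rightarrow> 'k::field"
  assumes g: "window n g" and gh: "mat_mult g h = mat_one" "mat_mult h g = mat_one" and c: "cut c g"
  shows "cut c h"
proof -
  have h: "window n h" using window_inverse[OF g gh] .
  define F where "F = {-n..c} \<inter> {-n..n}"
  let ?E = "unit_col ` F :: (int \<Rightarrow> 'k) set"
  have fin: "finite F" by (simp add: F_def)
  interpret G: Vector_Spaces.linear col_scale col_scale "mat_vec g" using g by (rule linear_mat_vec)
  have left_inv: "mat_vec h (mat_vec g v) = v" if "v \<in> fin_columns" for v
    using mat_vec_mult[OF h g that] gh by simp
  have inj: "inj_on (mat_vec g) (col.span ?E)"
    by (rule inj_on_inverseI[of _ "mat_vec h"])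
      (use left_inv in \<open>simp add: span_unit_col supported_on_def\<close>)
  let ?S = "mat_vec g ` ?E"
  have indep: "col.independent ?S"
    using G.independent_injective_image[OF independent_unit_col inj] .
  have "mat_vec g (unit_col j) \<in> supported_on F" if j: "j \<in> F" for j
  proof -
    have "g i j = 0" if "i \<notin> F" for i
    proof (cases "i \<le> c")
      case True
      with \<open>i \<notin> F\<close> have "\<bar>i\<bar> > n" by (auto simp: F_def)
      with g have "g i j = mat_one i j" by (simp add: window_def)
      with j \<open>i \<notin> F\<close> show ?thesis by (auto simp: mat_one_def)
    next
      case False
      with j c show ?thesis by (simp add: cut_def F_def)
    qed
    moreover have "finite {i. g i j \<noteq> 0}" using g by (rule window_col)
    ultimately show ?thesis
      by (auto simp: mat_vec_unit_col supported_on_def fin_columns_def)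
  qed
  then have sub: "?S \<subseteq> col.span ?E" by (auto simp: span_unit_col)
  obtain T where T: "card T = card ?E" "finite T" "?S \<subseteq> T" "T \<subseteq> ?S \<union> ?E" "?S \<subseteq> col.span T"
    using col.exchange_lemma[OF _ indep sub] fin by auto
  have "card ?S = card ?E"
    using inj col.span_superset by (intro card_image) (rule inj_on_subset)
  have "col.span ?E \<subseteq> col.span ?S"
  proof (rule ccontr)
    assume "\<not> col.span ?E \<subseteq> col.span ?S"
    then obtain x where x: "x \<in> col.span ?E" "x \<notin> col.span ?S" by blast
    have "col.independent (insert x ?S)"
      using indep x by (simp add: col.independent_insert)
    moreover have "insert x ?S \<subseteq> col.span ?E" using sub x by simp
    ultimately have "card (insert x ?S) \<le> card ?E"
      using col.independent_span_bound[of ?E "insert x ?S"] fin by simp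
    moreover have "x \<notin> ?S" using x(2) col.span_superset[of ?S] by (meson subsetD)
    then have "card (insert x ?S) = Suc (card ?S)" using fin by (intro card_insert_disjoint) simp_all
    ultimately show False using \<open>card ?S = card ?E\<close> by linarith
  qed
  then have surj: "supported_on F \<subseteq> mat_vec g ` supported_on F"
    using G.span_image[of ?E] by (simp add: span_unit_col)
  show ?thesis
    unfolding cut_def
  proof (intro allI impI)
    fix i j
    assume ij: "j \<le> c \<and> c < i"
    show "h i j = 0"
    proof (cases "\<bar>j\<bar> > n")
      case True
      with h have "h i j = mat_one i j" by (simp add: window_def)
      with ij show ?thesis by (simp add: mat_one_def)
    next
      case False
      with ij have "j \<in> F" by (auto simp: F_def)
      then obtain w where w: "w \<in> supported_on F" "unit_col j = mat_vec g w"
        using surj unit_col_supported_on by blast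
      then have "w = mat_vec h (unit_col j)"
        using left_inv by (simp add: supported_on_def)
      then have "w i = h i j" by (simp add: mat_vec_unit_col)
      moreover have "i \<notin> F" using ij by (auto simp: F_def)
      then have "w i = 0" using w(1) unfolding supported_on_def by blast
      ultimately show ?thesis by simp
    qed
  qed
qed

lemma mid_mult:
  assumes "cut (fst \<alpha>) g" "cut (snd \<alpha>) h" "i \<in> mid_idx \<alpha>" "j \<in> mid_idx \<alpha>"
    and "\<forall>i \<in> mid_idx \<alpha>. \<forall>j \<in> mid_idx \<alpha>. h i j = mat_one i j"
  shows "mat_mult g h i j = g i j"
proof -
  have "g i l * h l j = g i l * mat_one l j" for l
    using assms by (cases "l \<le> fst \<alpha>"; cases "l \<le> snd \<alpha>") (auto simp: cut_def mid_idx_def mat_one_def)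
  then have *: "(\<lambda>l. g i l * h l j) = (\<lambda>l. g i l * mat_one l j)" by blast
  show ?thesis unfolding mat_mult_def * by (rule Sum_any_delta_right)
qed

lemma Q_carrier: "Q \<alpha> \<subseteq> carrier GL2inf"
  by (auto simp: Q_def)

lemma subgroup_Q:
  assumes "\<alpha> \<in> index_pairs" shows "subgroup (Q \<alpha> :: (int \<Rightarrow> int \<Rightarrow> 'k::field) set) GL2inf"
proof -
  interpret group "GL2inf :: (int \<Rightarrow> int \<Rightarrow> 'k) monoid" by (rule group_GL2inf)
  show ?thesis
  proof (rule subgroupI)
    have "(mat_one :: int \<Rightarrow> int \<Rightarrow> 'k) \<in> Q \<alpha>"
      using one_closed by (simp add: Q_iff[OF assms] cut_def) (simp add: mat_one_def)
    then show "Q \<alpha> \<noteq> ({} :: (int \<Rightarrow> int \<Rightarrow> 'k) set)" by blast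
  next
    fix a :: "int \<Rightarrow> int \<Rightarrow> 'k" assume a: "a \<in> Q \<alpha>"
    let ?b = "inv\<^bsub>GL2inf\<^esub> a"
    have ac: "a \<in> carrier GL2inf" using a Q_carrier by blast
    then obtain n where n: "window n a" using GL2inf_window by blast
    have ab: "mat_mult a ?b = mat_one" "mat_mult ?b a = mat_one"
      using r_inv[OF ac] l_inv[OF ac] by simp_all
    have cuts: "cut (fst \<alpha>) ?b" "cut (snd \<alpha>) ?b"
      using cut_inverse[OF n ab] a by (auto simp: Q_iff[OF assms])
    have "?b i j = mat_one i j" if "i \<in> mid_idx \<alpha>" "j \<in> mid_idx \<alpha>" for i j
      using mid_mult[OF cuts(1), of a i j] a that ab by (simp add: Q_iff[OF assms])
    then show "?b \<in> Q \<alpha>" using cuts ac by (simp add: Q_iff[OF assms])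
  next
    fix a b :: "int \<Rightarrow> int \<Rightarrow> 'k" assume a: "a \<in> Q \<alpha>" and b: "b \<in> Q \<alpha>"
    have ab: "mat_mult a b \<in> carrier GL2inf"
      using m_closed[of a b] a b Q_carrier by (metis GL2inf_simps(1) subsetD)
    have "mat_mult a b i j = mat_one i j" if "i \<in> mid_idx \<alpha>" "j \<in> mid_idx \<alpha>" for i j
      using mid_mult[of \<alpha> a b i j] a b that by (simp add: Q_iff[OF assms])
    with ab a b show "a \<otimes>\<^bsub>GL2inf\<^esub> b \<in> Q \<alpha>"
      by (simp add: Q_iff[OF assms] cut_mult)
  qed (rule Q_carrier)
qed


subsection \<open>Invariance of \<open>\<chi>\<close> and \<open>\<eta>\<close>\<close>

lemma fin_mat_vec:
  assumes "window n g" "v \<in> fin_columns" shows "mat_vec g v \<in> fin_columns"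
proof -
  have "mat_vec g v i = v i" if "\<bar>i\<bar> > n" for i
    using assms(1) that by (simp add: mat_vec_def window_def Sum_any_delta_left)
  then have "i \<in> {-n..n} \<union> {i. v i \<noteq> 0}" if "mat_vec g v i \<noteq> 0" for i
    using that by (cases "\<bar>i\<bar> > n") auto
  then have "{i. mat_vec g v i \<noteq> 0} \<subseteq> {-n..n} \<union> {i. v i \<noteq> 0}" by blast
  with assms(2) show ?thesis
    unfolding fin_columns_def by (auto intro: finite_subset)
qed

lemma Q_mat_vec:
  fixes r :: "int \<Rightarrow> int \<Rightarrow> 'k::field"
  assumes \<alpha>: "\<alpha> \<in> index_pairs" and r: "r \<in> Q \<alpha>"
    and y: "y \<in> supported_on (minus_idx \<alpha>)" and v: "v \<in> supported_on (mid_idx \<alpha>)"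
  shows "\<exists>z \<in> supported_on (minus_idx \<alpha>). mat_vec r (y + v) = z + v"
proof
  let ?z = "mat_vec r (y + v) - v"
  show "mat_vec r (y + v) = ?z + v" by simp
  obtain n where n: "window n r" using r Q_carrier GL2inf_window by blast
  have yv: "y \<in> supported_on UNIV" "v \<in> supported_on UNIV"
    using y v by (auto simp: supported_on_def)
  then have "y + v \<in> supported_on UNIV"
    using subspace_supported_on col.subspace_add by blast
  then have "mat_vec r (y + v) \<in> supported_on UNIV"
    using fin_mat_vec[OF n] by (simp add: supported_on_def)
  then have "?z \<in> supported_on UNIV"
    using yv subspace_supported_on col.subspace_diff by blast
  moreover have "?z i = 0" if i: "fst \<alpha> < i" for i
  proof -
    have 1: "r i l * y l = 0" for l
      using r y i by (cases "l \<le> fst \<alpha>") (auto simp: Q_iff[OF \<alpha>] cut_def supported_on_def minus_idx_def)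
    have 2: "r i l * v l = mat_one i l * v l" for l
    proof (cases "l \<in> mid_idx \<alpha>")
      case l: True
      show ?thesis
      proof (cases "i \<le> snd \<alpha>")
        case True
        with i l r show ?thesis by (auto simp: Q_iff[OF \<alpha>] mid_idx_def)
      next
        case False
        with l r have "r i l = 0" by (auto simp: Q_iff[OF \<alpha>] cut_def mid_idx_def)
        with False l show ?thesis by (auto simp: mat_one_def mid_idx_def)
      qed
    next
      case False
      with v have "v l = 0" by (auto simp: supported_on_def)
      then show ?thesis by simp
    qed
    have "mat_vec r (y + v) i = v i"
      by (simp add: mat_vec_def distrib_left 1 2 Sum_any_delta_left)
    then show ?thesis by simp
  qed
  ultimately show "?z \<in> supported_on (minus_idx \<alpha>)"
    by (auto simp: supported_on_def minus_idx_def not_less[symmetric])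
qed

lemma chi_mono:
  fixes A q r :: "int \<Rightarrow> int \<Rightarrow> 'k::field"
  assumes \<alpha>: "\<alpha> \<in> index_pairs" and \<beta>: "\<beta> \<in> index_pairs"
    and A: "A \<in> carrier GL2inf" and q: "q \<in> Q \<alpha>" and r: "r \<in> Q \<beta>"
  shows "chi \<alpha> \<beta> A \<subseteq> chi \<alpha> \<beta> (mat_mult q (mat_mult A r))"
proof clarify
  interpret group "GL2inf :: (int \<Rightarrow> int \<Rightarrow> 'k) monoid" by (rule group_GL2inf)
  fix v u
  assume "(v, u) \<in> chi \<alpha> \<beta> A"
  then obtain x y where
    vu: "v \<in> supported_on (mid_idx \<beta>)" "u \<in> supported_on (mid_idx \<alpha>)" and
    x: "x \<in> supported_on (minus_idx \<alpha>)" and y: "y \<in> supported_on (minus_idx \<beta>)" and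
    xy: "x + u = mat_vec A (y + v)"
    by (auto simp: chi_def)
  have rc: "r \<in> carrier GL2inf" and qc: "q \<in> carrier GL2inf" using q r Q_carrier by blast+
  let ?s = "inv\<^bsub>GL2inf\<^esub> r"
  have s: "?s \<in> Q \<beta>" using subgroup.m_inv_closed[OF subgroup_Q[OF \<beta>] r] .
  have rs: "mat_mult r ?s = mat_one" using r_inv[OF rc] by simp
  obtain y' where y': "y' \<in> supported_on (minus_idx \<beta>)" "mat_vec ?s (y + v) = y' + v"
    using Q_mat_vec[OF \<beta> s y vu(1)] by blast
  obtain x' where x': "x' \<in> supported_on (minus_idx \<alpha>)" "mat_vec q (x + u) = x' + u"
    using Q_mat_vec[OF \<alpha> q x vu(2)] by blast
  obtain k l m p where w: "window k q" "window l A" "window m r" "window p ?s"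
    using GL2inf_window qc A rc inv_closed[OF rc] by metis
  obtain t where w2: "window t (mat_mult A r)"
    using GL2inf_window m_closed[OF A rc] by auto
  have fin: "y \<in> supported_on UNIV" "v \<in> supported_on UNIV" "y' \<in> supported_on UNIV"
    using y y' vu by (auto simp: supported_on_def)
  then have "y + v \<in> supported_on UNIV" "y' + v \<in> supported_on UNIV"
    using subspace_supported_on col.subspace_add by blast+
  then have f: "y + v \<in> fin_columns" "y' + v \<in> fin_columns"
    by (simp_all add: supported_on_def)
  have "mat_vec r (y' + v) = y + v"
    using mat_vec_mult[OF w(3) w(4) f(1)] rs y' by simp
  then have eq: "x' + u = mat_vec (mat_mult q (mat_mult A r)) (y' + v)"
    using mat_vec_mult[OF w(1) w2 f(2)] mat_vec_mult[OF w(2,3) f(2)] xy x' by simp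
  show "(v, u) \<in> chi \<alpha> \<beta> (mat_mult q (mat_mult A r))"
    unfolding chi_def mem_Collect_eq prod.case using vu x'(1) y'(1) eq by blast
qed

lemma eta_le:
  fixes A q r :: "int \<Rightarrow> int \<Rightarrow> 'k::field"
  assumes \<alpha>: "\<alpha> \<in> index_pairs" and \<beta>: "\<beta> \<in> index_pairs"
    and A: "A \<in> carrier GL2inf" and q: "q \<in> Q \<alpha>" and r: "r \<in> Q \<beta>"
  shows "eta \<alpha> \<beta> (mat_mult q (mat_mult A r)) \<le> eta \<alpha> \<beta> A"
proof -
  interpret group "GL2inf :: (int \<Rightarrow> int \<Rightarrow> 'k) monoid" by (rule group_GL2inf)
  have rc: "r \<in> carrier GL2inf" and qc: "q \<in> carrier GL2inf" using q r Q_carrier by blast+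
  obtain k l m where w: "window k q" "window l A" "window m r"
    using GL2inf_window qc A rc by metis
  obtain t where w2: "window t (mat_mult A r)"
    using GL2inf_window m_closed[OF A rc] by auto
  define P :: "(int \<Rightarrow> 'k) \<Rightarrow> int \<Rightarrow> 'k" where "P v = (\<lambda>i. if i \<in> plus_idx \<alpha> then v i else 0)" for v
  define colA where "colA B = (\<lambda>j i. if i \<in> plus_idx \<alpha> then B i j else (0::'k)) ` minus_idx \<beta>" for B
  have colA_alt: "colA B = (\<lambda>j. P (mat_vec B (unit_col j))) ` minus_idx \<beta>" for B
    by (simp add: colA_def P_def mat_vec_unit_col)
  have P: "Vector_Spaces.linear col_scale col_scale P"
    by unfold_locales (auto simp: P_def col_scale_def fun_eq_iff)
  note Alin = linear_mat_vec[OF w(2)] and qlin = linear_mat_vec[OF w(1)]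
  have PA: "Vector_Spaces.linear col_scale col_scale (P \<circ> mat_vec A)"
    by (rule Vector_Spaces.linear_compose[OF Alin P])
  have Pq: "Vector_Spaces.linear col_scale col_scale (P \<circ> mat_vec q)"
    by (rule Vector_Spaces.linear_compose[OF qlin P])
  interpret PA: Vector_Spaces.linear col_scale col_scale "P \<circ> mat_vec A" by (rule PA)
  interpret Pq: Vector_Spaces.linear col_scale col_scale "P \<circ> mat_vec q" by (rule Pq)
  have span: "col.span (colA A) = (P \<circ> mat_vec A) ` supported_on (minus_idx \<beta>)"
    using PA.span_image[of "unit_col ` minus_idx \<beta>"]
    by (simp add: colA_alt span_unit_col image_image)
  have "finite (colA A)"
  proof (rule finite_subset)
    show "colA A \<subseteq> insert 0 ((\<lambda>j. P (mat_vec A (unit_col j))) ` ({-l..l} \<union> {snd \<alpha>..fst \<beta>}))"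
    proof
      fix c assume "c \<in> colA A"
      then obtain j where j: "j \<in> minus_idx \<beta>" "c = P (mat_vec A (unit_col j))"
        by (auto simp: colA_alt)
      show "c \<in> insert 0 ((\<lambda>j. P (mat_vec A (unit_col j))) ` ({-l..l} \<union> {snd \<alpha>..fst \<beta>}))"
      proof (cases "j \<in> {-l..l} \<union> {snd \<alpha>..fst \<beta>}")
        case True with j show ?thesis by blast
      next
        case False
        then have "\<bar>j\<bar> > l" "j < snd \<alpha>" using j by (auto simp: minus_idx_def)
        then have "c i = 0" for i
          using w(2) by (auto simp: j P_def mat_vec_unit_col window_def plus_idx_def mat_one_def)
        then show ?thesis by (auto simp: fun_eq_iff)
      qed
    qed
  qed simp
  obtain B where B: "B \<subseteq> colA A" "col.independent B" "colA A \<subseteq> col.span B" "card B = col.dim (colA A)"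
    using col.basis_exists[of "colA A"] by blast
  have finB: "finite B" using B \<open>finite (colA A)\<close> finite_subset by blast
  have "colA (mat_mult q (mat_mult A r)) \<subseteq> col.span ((P \<circ> mat_vec q) ` B)"
  proof
    fix c assume "c \<in> colA (mat_mult q (mat_mult A r))"
    then obtain j where j: "j \<in> minus_idx \<beta>"
      and c: "c = P (mat_vec (mat_mult q (mat_mult A r)) (unit_col j))"
      by (auto simp: colA_alt)
    let ?w = "mat_vec A (mat_vec r (unit_col j))"
    have uj: "unit_col j \<in> supported_on (minus_idx \<beta>)" using j by (rule unit_col_supported_on)
    have "(0 :: int \<Rightarrow> 'k) \<in> supported_on (mid_idx \<beta>)"
      by (simp add: supported_on_def fin_columns_def)
    from Q_mat_vec[OF \<beta> r uj this]
    have rj: "mat_vec r (unit_col j) \<in> supported_on (minus_idx \<beta>)" by auto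
    have c2: "c = P (mat_vec q ?w)"
      using c mat_vec_mult[OF w(1) w2 unit_col_fin] mat_vec_mult[OF w(2,3) unit_col_fin] by simp
    have "P (mat_vec q ?w) = P (mat_vec q (P ?w))"
    proof
      fix i
      have "q i s * ?w s = q i s * P ?w s" if "i \<in> plus_idx \<alpha>" for s
        using q that by (auto simp: P_def Q_iff[OF \<alpha>] cut_def plus_idx_def)
      then have "(\<lambda>s. q i s * ?w s) = (\<lambda>s. q i s * P ?w s)" if "i \<in> plus_idx \<alpha>"
        using that by blast
      then have "mat_vec q ?w i = mat_vec q (P ?w) i" if "i \<in> plus_idx \<alpha>"
        using that unfolding mat_vec_def[of q] by presburger
      then show "P (mat_vec q ?w) i = P (mat_vec q (P ?w)) i"
        by (simp add: P_def[of "mat_vec q _"])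
    qed
    moreover have "P ?w \<in> col.span (colA A)"
      using rj by (auto simp: span)
    then have "P ?w \<in> col.span B" using B col.span_mono col.span_span by blast
    ultimately show "c \<in> col.span ((P \<circ> mat_vec q) ` B)"
      using c2 Pq.span_image[of B] by auto
  qed
  then have "col.dim (colA (mat_mult q (mat_mult A r))) \<le> card ((P \<circ> mat_vec q) ` B)"
    using finB by (intro col.dim_le_card) auto
  also have "\<dots> \<le> card B" using finB by (rule card_image_le)
  finally show ?thesis using B by (simp add: eta_def block_rank_def colA_def)
qed

lemma double_coset_mem_iff:
  "B \<in> double_coset \<alpha> \<beta> A \<longleftrightarrow> (\<exists>q \<in> Q \<alpha>. \<exists>r \<in> Q \<beta>. B = mat_mult q (mat_mult A r))"
  by (auto simp: double_coset_def set_mult_def l_coset_def)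

lemma chi_eta_invariant:
  fixes A B :: "int \<Rightarrow> int \<Rightarrow> 'k::field"
  assumes \<alpha>: "\<alpha> \<in> index_pairs" and \<beta>: "\<beta> \<in> index_pairs"
    and A: "A \<in> carrier GL2inf" and B: "B \<in> double_coset \<alpha> \<beta> A"
  shows "chi \<alpha> \<beta> B = chi \<alpha> \<beta> A" "eta \<alpha> \<beta> B = eta \<alpha> \<beta> A"
proof -
  interpret group "GL2inf :: (int \<Rightarrow> int \<Rightarrow> 'k) monoid" by (rule group_GL2inf)
  obtain q r where q: "q \<in> Q \<alpha>" and r: "r \<in> Q \<beta>" and B: "B = mat_mult q (mat_mult A r)"
    using B by (auto simp: double_coset_mem_iff)
  have rc: "r \<in> carrier GL2inf" and qc: "q \<in> carrier GL2inf" using q r Q_carrier by blast+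
  let ?q = "inv\<^bsub>GL2inf\<^esub> q" and ?r = "inv\<^bsub>GL2inf\<^esub> r"
  have qi: "?q \<in> Q \<alpha>" using subgroup.m_inv_closed[OF subgroup_Q[OF \<alpha>] q] .
  have ri: "?r \<in> Q \<beta>" using subgroup.m_inv_closed[OF subgroup_Q[OF \<beta>] r] .
  have Bc: "B \<in> carrier GL2inf" using m_closed[OF qc m_closed[OF A rc]] B by simp
  have "?q \<otimes>\<^bsub>GL2inf\<^esub> (q \<otimes>\<^bsub>GL2inf\<^esub> (A \<otimes>\<^bsub>GL2inf\<^esub> r) \<otimes>\<^bsub>GL2inf\<^esub> ?r) = A"
    using A qc rc by (simp only: m_assoc m_closed inv_closed r_inv r_one)
      (simp only: m_assoc[symmetric] inv_closed l_inv l_one)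
  then have A': "A = mat_mult ?q (mat_mult B ?r)" by (simp add: B)
  show "chi \<alpha> \<beta> B = chi \<alpha> \<beta> A"
    using chi_mono[OF \<alpha> \<beta> A q r, folded B] chi_mono[OF \<alpha> \<beta> Bc qi ri, folded A']
    by (rule subset_antisym[rotated])
  show "eta \<alpha> \<beta> B = eta \<alpha> \<beta> A"
    using eta_le[OF \<alpha> \<beta> A q r, folded B] eta_le[OF \<alpha> \<beta> Bc qi ri, folded A']
    by (rule le_antisym)
qed

lemma double_coset_self:
  assumes "\<alpha> \<in> index_pairs" "\<beta> \<in> index_pairs"
  shows "A \<in> double_coset \<alpha> \<beta> A"
  using subgroup.one_closed[OF subgroup_Q[OF assms(1)]] subgroup.one_closed[OF subgroup_Q[OF assms(2)]]
  by (force simp: double_coset_mem_iff)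

lemma chi_coset_eq:
  assumes "\<alpha> \<in> index_pairs" "\<beta> \<in> index_pairs" "A \<in> carrier GL2inf"
  shows "chi_coset \<alpha> \<beta> (double_coset \<alpha> \<beta> A) = chi \<alpha> \<beta> A"
  unfolding chi_coset_def
proof (rule the_equality)
  show "\<forall>B \<in> double_coset \<alpha> \<beta> A. chi \<alpha> \<beta> B = chi \<alpha> \<beta> A"
    using chi_eta_invariant(1)[OF assms] by (rule ballI)
next
  fix R
  assume "\<forall>B \<in> double_coset \<alpha> \<beta> A. chi \<alpha> \<beta> B = R"
  from bspec[OF this double_coset_self[OF assms(1,2)]] show "R = chi \<alpha> \<beta> A" by (rule sym)
qed

lemma eta_coset_eq:
  assumes "\<alpha> \<in> index_pairs" "\<beta> \<in> index_pairs" "A \<in> carrier GL2inf"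
  shows "eta_coset \<alpha> \<beta> (double_coset \<alpha> \<beta> A) = eta \<alpha> \<beta> A"
  unfolding eta_coset_def
proof (rule the_equality)
  show "\<forall>B \<in> double_coset \<alpha> \<beta> A. eta \<alpha> \<beta> B = eta \<alpha> \<beta> A"
    using chi_eta_invariant(2)[OF assms] by (rule ballI)
next
  fix n
  assume "\<forall>B \<in> double_coset \<alpha> \<beta> A. eta \<alpha> \<beta> B = n"
  from bspec[OF this double_coset_self[OF assms(1,2)]] show "n = eta \<alpha> \<beta> A" by (rule sym)
qed

end

theory Submission
  imports Defs
begin

text \<open>A matrix \<open>A\<close> gives the space of columns two flags: the \<open>\<beta>\<close>-flag \<open>E\<^sub>0 \<subseteq> E\<close> of columns
  supported on \<open>j \<le> \<beta>\<^sub>-\<close> and on \<open>j \<le> \<beta>\<^sub>+\<close>, and the preimage \<open>G\<^sub>0 \<subseteq> G\<close> under \<open>A\<close> of the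
  \<open>\<alpha>\<close>-flag.  The quotients \<open>E / E\<^sub>0\<close> and \<open>G / G\<^sub>0\<close> are identified with \<open>k\<^sub>\<beta>\<close> and \<open>k\<^sub>\<alpha>\<close> by
  the middle blocks \<open>p x\<close> of \<open>x\<close> and \<open>f x\<close> of \<open>A x\<close>.  The double coset of \<open>A\<close> consists of the
  matrices \<open>A'\<close> for which some \<open>r\<close> in the group carries these data to the data \<open>G'\<^sub>0 \<subseteq> G'\<close>, \<open>f'\<close> of
  \<open>A'\<close>: that \<open>r\<close> preserves \<open>E\<close> and \<open>p\<close> says \<open>r \<in> Q \<beta>\<close>, and that it carries \<open>G\<close>, \<open>f\<close> to
  \<open>G'\<close>, \<open>f'\<close> says \<open>A' r A\<inverse> \<in> Q \<alpha>\<close>.  So the task is to construct \<open>r\<close>.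

  Both matrices are the identity outside a finite window, so everything takes place in the
  finite-dimensional space \<open>W\<close> of columns supported on \<open>[-N, N]\<close>.  There \<open>\<chi>\<close> is the image of
  \<open>E \<inter> G\<close> under \<open>(p, f)\<close> (\<open>chi_eq_image\<close>), and \<open>\<eta>\<close> is the codimension of \<open>E\<^sub>0 \<inter> G\<close> in
  \<open>E\<^sub>0\<close> (\<open>dim_kernel_low_plus_eta\<close>), while the dimension of \<open>G\<^sub>0\<close> is the same for
  all matrices because they are invertible on \<open>W\<close> (\<open>dim_kernel_low_preimage\<close>).

  The map \<open>r\<close> is built from the inside out (\<open>flag_pair_isomorphism\<close>).  As \<open>\<chi>\<close> is the same for
  both matrices, \<open>E \<inter> G\<close> and \<open>E \<inter> G'\<close> have the same image under \<open>(p, f)\<close> and \<open>(p, f')\<close>, and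
  the equality of \<open>\<eta>\<close> makes the kernels \<open>E\<^sub>0 \<inter> G\<^sub>0\<close> and \<open>E\<^sub>0 \<inter> G'\<^sub>0\<close> equidimensional; hence
  there is an isomorphism \<open>E \<inter> G \<rightarrow> E \<inter> G'\<close> over \<open>\<chi>\<close>.  It extends to \<open>E \<rightarrow> E\<close> over \<open>k\<^sub>\<beta>\<close> and to
  \<open>G \<rightarrow> G'\<close> over \<open>k\<^sub>\<alpha>\<close>; these two maps glue to \<open>E + G \<rightarrow> E + G'\<close>, and by dimension the result
  extends to \<open>W\<close>.  All extensions over something are instances of \<open>lift_isomorphism\<close>.\<close>

section \<open>Linear maps with prescribed behaviour on subspaces\<close>

abbreviation (input) endo :: "('k::field \<Rightarrow> 'v::ab_group_add \<Rightarrow> 'v) \<Rightarrow> ('v \<Rightarrow> 'v) \<Rightarrow> bool"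
  where "endo s f \<equiv> Vector_Spaces.linear s s f"

context vector_space
begin

text \<open>A linear map given on \<open>Y\<close> may be continued to \<open>Y + X\<close> with
  freely chosen values \<open>g\<close> on a basis \<open>C\<close> of a complement, and \<open>C\<close> can be taken inside \<open>X\<close>.
  A property of pairs closed under linear combinations passes to the extension as soon as
  \<open>r0\<close> has it on \<open>Y\<close> and \<open>g\<close> has it pointwise.\<close>

lemma extend_linear_by_choice:
  assumes r0: "endo scale r0" and Y: "subspace Y"
  obtains r C where "endo scale r" "\<And>y. y \<in> Y \<Longrightarrow> r y = r0 y" "C \<subseteq> X" "X \<subseteq> span (Y \<union> C)"
    "\<And>c. c \<in> C \<Longrightarrow> r c = g c"
proof -
  interpret E: vector_space_pair scale scale by unfold_locales
  obtain B where B: "B \<subseteq> Y" "independent B" "Y \<subseteq> span B"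
    using basis_exists by metis
  have "B \<subseteq> B \<union> X" by blast
  then obtain D where D: "B \<subseteq> D" "D \<subseteq> B \<union> X" "independent D" "B \<union> X \<subseteq> span D"
    using maximal_independent_subset_extend B(2) by metis
  obtain r where r: "endo scale r" "\<forall>x\<in>D. r x = (if x \<in> B then r0 x else g x)"
    using E.linear_independent_extend[OF D(3), of "\<lambda>x. if x \<in> B then r0 x else g x"] by blast
  show thesis
  proof (rule that[OF r(1)])
    fix y assume "y \<in> Y"
    then have "y \<in> span B" using B by blast
    then show "r y = r0 y"
      by (rule E.linear_eq_on[OF r(1) r0]) (use r(2) D(1) in auto)
  next
    show "D - B \<subseteq> X" using D by blast
    have "D \<subseteq> Y \<union> (D - B)" using B by blast
    then show "X \<subseteq> span (Y \<union> (D - B))" using D(4) span_mono by blast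
    show "r c = g c" if "c \<in> D - B" for c using that r(2) by auto
  qed
qed

lemma span_Un_subspace:
  assumes "subspace Y" "x \<in> span (Y \<union> C)"
  obtains y c where "y \<in> Y" "c \<in> span C" "x = y + c"
proof -
  have "span Y = Y" using assms(1) by (simp add: span_eq_iff)
  with assms(2) show thesis using that by (auto simp: span_Un)
qed

text \<open>A complement of \<open>X1 \<inter> X2\<close> in \<open>X2\<close> is also one of \<open>X1\<close> in \<open>X1 + X2\<close>, so \<open>r1\<close> can be
  continued by the values of \<open>r2\<close> on it.\<close>

lemma glue_linear:
  assumes r1: "endo scale r1" and r2: "endo scale r2" and X1: "subspace X1" and X2: "subspace X2"
    and agree: "\<And>x. x \<in> X1 \<Longrightarrow> x \<in> X2 \<Longrightarrow> r1 x = r2 x"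
  obtains r where "endo scale r" "\<And>x. x \<in> X1 \<Longrightarrow> r x = r1 x" "\<And>x. x \<in> X2 \<Longrightarrow> r x = r2 x"
proof -
  interpret E: vector_space_pair scale scale by unfold_locales
  obtain C r where r: "endo scale r" "\<And>x. x \<in> X1 \<Longrightarrow> r x = r1 x"
    and C: "C \<subseteq> X2" "X2 \<subseteq> span (X1 \<union> C)" "\<And>c. c \<in> C \<Longrightarrow> r c = r2 c"
    using extend_linear_by_choice[OF r1 X1] by metis
  have "r x = r2 x" if x: "x \<in> X2" for x
  proof -
    obtain y c where y: "y \<in> X1" and c: "c \<in> span C" and xyc: "x = y + c"
      using span_Un_subspace[OF X1] C(2) x by blast
    have "c \<in> X2" using c C(1) X2 span_minimal by blast
    then have "y \<in> X2" using subspace_diff[OF X2 x] xyc by force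
    then have "r y = r2 y" using y r agree by simp
    moreover have "r c = r2 c" by (rule E.linear_eq_on[OF r(1) r2 c]) (rule C(3))
    ultimately show ?thesis by (simp add: xyc E.linear_add[OF r(1)] E.linear_add[OF r2])
  qed
  with r show thesis using that by blast
qed

lemma finite_basis_extend:
  assumes "finite S" "X \<subseteq> span S" "B \<subseteq> X" "independent B"
  obtains D where "B \<subseteq> D" "D \<subseteq> X" "finite D" "independent D" "X \<subseteq> span D" "card D = dim X"
proof -
  obtain D where D: "B \<subseteq> D" "D \<subseteq> X" "independent D" "X \<subseteq> span D"
    using maximal_independent_subset_extend[OF assms(3,4)] .
  have "D \<subseteq> span S" using D(2) assms(2) by blast
  then have "finite D" using independent_span_bound[OF assms(1) D(3)] by blast
  then show thesis using that[OF D(1,2) _ D(3,4)] basis_card_eq_dim[OF D(2,4,3)] by simp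
qed

text \<open>Rank-nullity for a finite-dimensional subspace of a space of arbitrary dimension.\<close>

lemma dim_kernel_plus_image:
  assumes f: "endo scale f" and X: "subspace X" and fin: "finite S" "X \<subseteq> span S"
  shows "dim X = dim {x \<in> X. f x = 0} + dim (f ` X)"
proof -
  interpret f: Vector_Spaces.linear scale scale f by (rule f)
  interpret E: vector_space_pair scale scale by unfold_locales
  let ?K = "{x \<in> X. f x = 0}"
  have K: "subspace ?K"
    using subspace_inter[OF X f.subspace_kernel] by (simp add: Int_def)
  have KS: "?K \<subseteq> span S" using fin(2) by blast
  obtain B where B: "{} \<subseteq> B" "B \<subseteq> ?K" "finite B" "independent B" "?K \<subseteq> span B" "card B = dim ?K"
    using finite_basis_extend[OF fin(1) KS empty_subsetI independent_empty] .
  have BX: "B \<subseteq> X" using B(2) by blast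
  obtain D where D: "B \<subseteq> D" "D \<subseteq> X" "finite D" "independent D" "X \<subseteq> span D" "card D = dim X"
    using finite_basis_extend[OF fin BX B(4)] .
  let ?C = "D - B"
  \<comment> \<open>The projection \<open>g\<close> along \<open>span B\<close> separates \<open>span B\<close> from the span of \<open>D - B\<close>.\<close>
  obtain g where g: "endo scale g" "\<forall>x\<in>D. g x = (if x \<in> B then 0 else x)"
    using E.linear_independent_extend[OF D(4), of "\<lambda>x. if x \<in> B then 0 else x"] by blast
  have "inj_on f (span ?C)"
    unfolding f.inj_on_iff_eq_0[OF subspace_span]
  proof (intro ballI impI)
    fix x assume x: "x \<in> span ?C" "f x = 0"
    have "span ?C \<subseteq> X" using D X by (intro span_minimal) auto
    then have "x \<in> span B" using x B(5) by blast
    then have "g x = 0"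
      by (rule E.linear_eq_on[OF g(1) E.linear_zero]) (use g(2) D(1) in auto)
    moreover have "g x = x"
      by (rule E.linear_eq_on[OF g(1) linear_ident x(1)]) (use g(2) in auto)
    ultimately show "x = 0" by simp
  qed
  then have indep: "independent (f ` ?C)" and inj: "inj_on f ?C"
    using f.independent_injective_image[of ?C] independent_mono[OF D(4)]
      inj_on_subset[OF _ span_superset[of ?C]] by auto
  have span: "f ` X \<subseteq> span (f ` ?C)"
  proof clarify
    fix x assume "x \<in> X"
    moreover have "B \<union> ?C = D" using D(1) by blast
    ultimately have "x \<in> span (B \<union> ?C)" using D(5) by auto
    then obtain b c where "b \<in> span B" "c \<in> span ?C" "x = b + c" unfolding span_Un by blast
    moreover have "f b = 0" using \<open>b \<in> span B\<close> span_minimal[OF B(2) K] by blast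
    ultimately show "f x \<in> span (f ` ?C)" by (simp add: f.add f.span_image)
  qed
  have "f ` ?C \<subseteq> f ` X" using D by blast
  from basis_card_eq_dim[OF this span indep] have "dim (f ` X) = card (f ` ?C)" ..
  also have "\<dots> = card D - card B" using inj B(3) D(1) by (simp add: card_image card_Diff_subset)
  finally show ?thesis using B D card_mono[of D B] by simp
qed

text \<open>A basis of \<open>U\<close> and its image complete to bases of \<open>K\<close> and \<open>K'\<close> by equally many vectors.\<close>

lemma extend_isomorphism:
  assumes r0: "endo scale r0" and U: "subspace U" "U \<subseteq> K" and K: "subspace K" and K': "subspace K'"
    and r0U: "inj_on r0 U" "r0 ` U \<subseteq> K'"
    and fin: "finite S" "K \<subseteq> span S" "finite S'" "K' \<subseteq> span S'" and dim: "dim K = dim K'"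
  obtains r where "endo scale r" "\<And>x. x \<in> U \<Longrightarrow> r x = r0 x" "bij_betw r K K'"
proof -
  interpret E: vector_space_pair scale scale by unfold_locales
  interpret r0: Vector_Spaces.linear scale scale r0 by (rule r0)
  obtain B where B: "B \<subseteq> U" "independent B" "U \<subseteq> span B"
    using maximal_independent_subset .
  have BU: "span B = U" using span_minimal[OF B(1) U(1)] B(3) by (rule subset_antisym)
  have BK: "B \<subseteq> K" and BK': "r0 ` B \<subseteq> K'" using B(1) U(2) r0U(2) by blast+
  have indep: "independent (r0 ` B)"
    using r0.independent_injective_image[OF B(2)] r0U(1) BU by simp
  have injB: "inj_on r0 B" using r0U(1) B(1) by (rule inj_on_subset)
  obtain D where D: "B \<subseteq> D" "D \<subseteq> K" "finite D" "independent D" "K \<subseteq> span D" "card D = dim K"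
    using finite_basis_extend[OF fin(1,2) BK B(2)] .
  obtain D' where D': "r0 ` B \<subseteq> D'" "D' \<subseteq> K'" "finite D'" "independent D'" "K' \<subseteq> span D'"
    "card D' = dim K'"
    using finite_basis_extend[OF fin(3,4) BK' indep] .
  have "finite B" using D(1,3) by (rule finite_subset)
  then have "card (D - B) = card (D' - r0 ` B)"
    using D(1,3,6) D'(1,3,6) dim injB by (simp add: card_Diff_subset card_image)
  then obtain h where h: "bij_betw h (D - B) (D' - r0 ` B)"
    using finite_same_card_bij D(3) D'(3) by (metis finite_Diff)
  obtain r where r: "endo scale r" "\<forall>x\<in>D. r x = (if x \<in> B then r0 x else h x)"
    using E.linear_independent_extend[OF D(4), of "\<lambda>x. if x \<in> B then r0 x else h x"] by blast
  interpret r: Vector_Spaces.linear scale scale r by (rule r(1))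
  have "bij_betw r B (r0 ` B)"
    using inj_on_imp_bij_betw[OF injB] r(2) D(1) by (subst bij_betw_cong[of _ _ r0]) auto
  moreover have "bij_betw r (D - B) (D' - r0 ` B)"
    using h r(2) by (subst bij_betw_cong[of _ _ h]) auto
  ultimately have "bij_betw r (B \<union> (D - B)) (r0 ` B \<union> (D' - r0 ` B))"
    by (rule bij_betw_combine) blast
  then have rD: "bij_betw r D D'"
    using D(1) D'(1) by (simp add: Un_absorb1)
  have KD: "span D = K" "span D' = K'"
    using span_minimal[OF D(2) K] span_minimal[OF D'(2) K'] D(5) D'(5) by auto
  have "inj_on r K"
    unfolding r.inj_on_iff_eq_0[OF K]
  proof (intro ballI impI)
    fix x assume "x \<in> K" "r x = 0"
    with E.linear_indep_image_lemma[OF r(1) D(3)] show "x = 0"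
      using rD D'(4) KD by (auto simp: bij_betw_def)
  qed
  moreover have "r ` K = K'"
    using r.span_image[of D] rD KD by (simp add: bij_betw_def)
  ultimately have "bij_betw r K K'" by (simp add: bij_betw_def)
  moreover have "r x = r0 x" if "x \<in> U" for x
    by (rule E.linear_eq_on[OF r(1) r0, of x B]) (use that BU r(2) D(1) in auto)
  ultimately show thesis using that[OF r(1)] by blast
qed

text \<open>A linear relation \<open>R\<close> between finite-dimensional spaces that is total on both sides contains the graph of an isomorphism as
  soon as its two kernels have equal dimension, and the isomorphism may be prescribed on \<open>U\<close>.
  First \<open>r0\<close> is extended over the kernel \<open>K\<close>, where it has to map onto \<open>K'\<close>; on a complement
  of \<open>U + K\<close> any choice of related vectors will do.  Relations \<open>p x = p' x'\<close> express that the
  isomorphism lies over a common quotient; a relation also covers pairs of such conditions.\<close>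

lemma lift_isomorphism:
  assumes R0: "R 0 0" and R_add: "\<And>x y x' y'. R x x' \<Longrightarrow> R y y' \<Longrightarrow> R (x + y) (x' + y')"
    and R_scale: "\<And>c x x'. R x x' \<Longrightarrow> R (scale c x) (scale c x')"
    and X: "subspace X" and X': "subspace X'" and fin: "finite S" "X \<subseteq> span S" "X' \<subseteq> span S"
    and total: "\<And>x. x \<in> X \<Longrightarrow> \<exists>x' \<in> X'. R x x'" "\<And>x'. x' \<in> X' \<Longrightarrow> \<exists>x \<in> X. R x x'"
    and dim: "dim {x \<in> X. R x 0} = dim {x' \<in> X'. R 0 x'}"
    and r0: "endo scale r0" and U: "subspace U" "U \<subseteq> X" and r0U: "inj_on r0 U" "r0 ` U \<subseteq> X'"
    and r0R: "\<And>x. x \<in> U \<Longrightarrow> R x (r0 x)"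
  obtains r where "endo scale r" "\<And>x. x \<in> U \<Longrightarrow> r x = r0 x" "bij_betw r X X'"
    "\<And>x. x \<in> X \<Longrightarrow> R x (r x)"
proof -
  interpret r0: Vector_Spaces.linear scale scale r0 by (rule r0)
  let ?K = "{x \<in> X. R x 0}" and ?K' = "{x' \<in> X'. R 0 x'}"
  have R_diff: "R (x - y) (x' - y')" if "R x x'" "R y y'" for x y x' y'
    using R_add[OF that(1) R_scale[OF that(2), of "-1"]] by simp
  have K: "subspace ?K" and K': "subspace ?K'"
    using X X' R0 R_add[of _ 0 _ 0] R_add[of 0 _ 0 _] R_scale[of _ 0] R_scale[of 0]
    by (auto simp: subspace_def)
  have UK: "subspace (U \<inter> ?K)" using U(1) K by (rule subspace_inter)
  have "R 0 (r0 x)" if "x \<in> U \<inter> ?K" for x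
    using R_diff[of x "r0 x" x 0] r0R that by simp
  then have r0K: "r0 ` (U \<inter> ?K) \<subseteq> ?K'" using r0U(2) by blast
  have KS: "?K \<subseteq> span S" "?K' \<subseteq> span S" using fin by blast+
  obtain r1 where r1: "endo scale r1" "\<And>x. x \<in> U \<inter> ?K \<Longrightarrow> r1 x = r0 x" "bij_betw r1 ?K ?K'"
    using extend_isomorphism[OF r0 UK Int_lower2 K K' inj_on_subset[OF r0U(1) Int_lower1] r0K
        fin(1) KS(1) fin(1) KS(2) dim] by blast
  obtain r2 where r2: "endo scale r2" "\<And>x. x \<in> U \<Longrightarrow> r2 x = r0 x" "\<And>x. x \<in> ?K \<Longrightarrow> r2 x = r1 x"
    using glue_linear[OF r0 r1(1) U(1) K] r1(2) by auto
  interpret r2: Vector_Spaces.linear scale scale r2 by (rule r2(1))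
  define g where "g x = (SOME x'. x' \<in> X' \<and> R x x')" for x
  have g: "g x \<in> X' \<and> R x (g x)" if "x \<in> X" for x
    unfolding g_def by (rule someI_ex) (use total(1)[OF that] in blast)
  obtain r C where r: "endo scale r" "\<And>x. x \<in> span (U \<union> ?K) \<Longrightarrow> r x = r2 x"
    and C: "C \<subseteq> X" "X \<subseteq> span (span (U \<union> ?K) \<union> C)" "\<And>c. c \<in> C \<Longrightarrow> r c = g c"
    by (rule extend_linear_by_choice[OF r2(1) subspace_span, of "U \<union> ?K" X g], rule that) assumption+
  interpret r: Vector_Spaces.linear scale scale r by (rule r(1))
  \<comment> \<open>The graph of \<open>r\<close> lies in \<open>R\<close>: this can be tested on \<open>U\<close>, on \<open>K\<close>, and on \<open>C\<close>, where it is the choice of \<open>g\<close>.\<close>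
  have r_U: "r x = r0 x" if "x \<in> U" for x
    using that r(2) r2(2) by (simp add: span_base)
  have r_K: "r x = r1 x" if "x \<in> ?K" for x
    using that r(2) r2(3) by (simp add: span_base)
  let ?Good = "{x. r x \<in> X' \<and> R x (r x)}"
  have good: "subspace ?Good"
    using X' R0 R_add R_scale by (auto simp: subspace_def r.add r.scale)
  have K_good: "?K \<subseteq> ?Good"
  proof
    fix x assume x: "x \<in> ?K"
    then have "r1 x \<in> ?K'" using r1(3) by (auto simp: bij_betw_def)
    then show "x \<in> ?Good" using R_add[of x 0 0 "r1 x"] x r_K[OF x] by simp
  qed
  have "U \<union> ?K \<subseteq> ?Good" using r_U r0R r0U(2) K_good by auto
  then have "span (U \<union> ?K) \<subseteq> ?Good" using good by (rule span_minimal)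
  moreover have "C \<subseteq> ?Good" using C g by auto
  ultimately have "span (span (U \<union> ?K) \<union> C) \<subseteq> ?Good" using good by (intro span_minimal) auto
  with C(2) have r_X: "r x \<in> X'" "R x (r x)" if "x \<in> X" for x using that by auto
  have "inj_on r X"
    unfolding r.inj_on_iff_eq_0[OF X]
  proof (intro ballI impI)
    fix x assume x: "x \<in> X" "r x = 0"
    then have xK: "x \<in> ?K" using r_X(2)[OF x(1)] by simp
    interpret r1: Vector_Spaces.linear scale scale r1 by (rule r1(1))
    have "r1 x = 0" using x r_K[OF xK] by simp
    then show "x = 0"
      using r1(3) xK r1.inj_on_iff_eq_0[OF K] by (auto simp: bij_betw_def)
  qed
  moreover have "x' \<in> r ` X" if x': "x' \<in> X'" for x'
  proof -
    obtain x where x: "x \<in> X" "R x x'" using total(2)[OF x'] by blast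
    \<comment> \<open>Both \<open>x'\<close> and \<open>r x\<close> are related to \<open>x\<close>, so they differ by an element of \<open>K' = r K\<close>.\<close>
    have "x' - r x \<in> X'" using X' x' r_X(1)[OF x(1)] by (rule subspace_diff)
    moreover have "R 0 (x' - r x)" using R_diff[OF x(2) r_X(2)[OF x(1)]] by simp
    ultimately have "x' - r x \<in> r1 ` ?K" using r1(3) by (simp add: bij_betw_def)
    then obtain y where y: "x' - r x = r1 y" "y \<in> ?K" by (rule imageE)
    have "r (x + y) = x'" using r_K[OF y(2)] by (simp add: r.add y(1)[symmetric])
    moreover have "x + y \<in> X" using X x(1) y(2) by (auto intro: subspace_add)
    ultimately show ?thesis by (metis imageI)
  qed
  ultimately have bij: "bij_betw r X X'" using r_X(1) by (auto simp: bij_betw_def)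
  show thesis
  proof (rule that[OF r(1) _ bij])
    show "r x = r0 x" if "x \<in> U" for x using that by (rule r_U)
    show "R x (r x)" if "x \<in> X" for x using that by (rule r_X(2))
  qed
qed

text \<open>The core of the classification.  The flags are \<open>E \<inter> ker p \<subseteq> E\<close> and
  \<open>G \<inter> ker f \<subseteq> G\<close>, respectively \<open>G' \<inter> ker f' \<subseteq> G'\<close>; the maps \<open>p\<close>, \<open>f\<close>, \<open>f'\<close> rigidify
  their quotients, so \<open>r\<close> has to induce the identity there.\<close>

lemma flag_pair_isomorphism:
  assumes p: "endo scale p" and f: "endo scale f" and f': "endo scale f'"
    and W: "subspace W" "finite S" "W \<subseteq> span S"
    and E: "subspace E" "E \<subseteq> W" and G: "subspace G" "G \<subseteq> W" and G': "subspace G'" "G' \<subseteq> W"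
    and rel: "(\<lambda>x. (p x, f x)) ` (E \<inter> G) = (\<lambda>x. (p x, f' x)) ` (E \<inter> G')"
    and im: "f ` G = f' ` G'"
    and dim_G: "dim {x \<in> G. f x = 0} = dim {x \<in> G'. f' x = 0}"
    and dim_E: "dim {x \<in> E \<inter> G. p x = 0} = dim {x \<in> E \<inter> G'. p x = 0}"
  obtains r where "endo scale r" "bij_betw r W W" "bij_betw r E E" "bij_betw r G G'"
    "\<And>x. x \<in> E \<Longrightarrow> p (r x) = p x" "\<And>x. x \<in> G \<Longrightarrow> f' (r x) = f x"
proof -
  interpret E: vector_space_pair scale scale by unfold_locales
  interpret p: Vector_Spaces.linear scale scale p by (rule p)
  interpret f: Vector_Spaces.linear scale scale f by (rule f)
  interpret f': Vector_Spaces.linear scale scale f' by (rule f')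
  have EG: "subspace (E \<inter> G)" "subspace (E \<inter> G')"
    using E(1) G(1) G'(1) by (simp_all add: subspace_inter)
  have sub: "E \<subseteq> span S" "G \<subseteq> span S" "G' \<subseteq> span S" "E \<inter> G \<subseteq> span S" "E \<inter> G' \<subseteq> span S"
    using E(2) G(2) G'(2) W(3) by blast+
  let ?I = "{x \<in> E \<inter> G. p x = 0}" and ?I' = "{x \<in> E \<inter> G'. p x = 0}"
  have I: "subspace ?I" "subspace ?I'"
    using subspace_inter[OF EG(1) p.subspace_kernel] subspace_inter[OF EG(2) p.subspace_kernel]
    by (simp_all add: Int_def)
  have IS: "?I \<subseteq> span S" "?I' \<subseteq> span S" using sub by blast+
  have "f ` ?I = f' ` ?I'"
  proof -
    have "f ` ?I = {u. (0, u) \<in> (\<lambda>x. (p x, f x)) ` (E \<inter> G)}" by auto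
    also have "\<dots> = f' ` ?I'" unfolding rel by auto
    finally show ?thesis .
  qed
  then have dim_I: "dim {x \<in> ?I. f x = 0} = dim {x \<in> ?I'. f' x = 0}"
    using dim_kernel_plus_image[OF f I(1) W(2) IS(1)] dim_kernel_plus_image[OF f' I(2) W(2) IS(2)]
      dim_E by simp
  \<comment> \<open>The isomorphism over the common linear relation.\<close>
  obtain r1 where r1: "endo scale r1" "bij_betw r1 (E \<inter> G) (E \<inter> G')"
    "\<And>x. x \<in> E \<inter> G \<Longrightarrow> p x = p (r1 x) \<and> f x = f' (r1 x)"
  proof (rule lift_isomorphism[where R = "\<lambda>x x'. p x = p x' \<and> f x = f' x'" and U = "{0}" and ?r0.0 = "\<lambda>x. 0"
        and X = "E \<inter> G" and X' = "E \<inter> G'" and S = S])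
    show "\<exists>x' \<in> E \<inter> G'. p x = p x' \<and> f x = f' x'" if "x \<in> E \<inter> G" for x
    proof -
      have "(p x, f x) \<in> (\<lambda>x. (p x, f' x)) ` (E \<inter> G')" using that rel by blast
      then show ?thesis by blast
    qed
    show "\<exists>x \<in> E \<inter> G. p x = p x' \<and> f x = f' x'" if "x' \<in> E \<inter> G'" for x'
    proof -
      have "(p x', f' x') \<in> (\<lambda>x. (p x, f x)) ` (E \<inter> G)" using that rel by blast
      then show ?thesis by force
    qed
    show "dim {x \<in> E \<inter> G. p x = p 0 \<and> f x = f' 0} = dim {x' \<in> E \<inter> G'. p 0 = p x' \<and> f 0 = f' x'}"
      using dim_I by (simp add: p.zero f.zero f'.zero eq_commute[of 0] conj_assoc)
    show "endo scale (\<lambda>x. 0)" by (rule E.linear_zero)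
  qed (use EG sub W(2) E(1) G(1) G'(1) in \<open>auto simp: p.add f.add f'.add p.scale f.scale f'.scale
      p.zero f.zero f'.zero subspace_0\<close>)
  have r1_eq: "p (r1 x) = p x" "f' (r1 x) = f x" if "x \<in> E" "x \<in> G" for x
    using r1(3)[of x] that by auto
  have r1_img: "r1 ` (E \<inter> G) \<subseteq> E" "r1 ` (E \<inter> G) \<subseteq> G'" and r1_inj: "inj_on r1 (E \<inter> G)"
    and r1_onto: "r1 ` (E \<inter> G) = E \<inter> G'"
    using r1(2) by (auto simp: bij_betw_def)
  have sum_E: "p (x + y) = p (x' + y')" if "p x = p x'" "p y = p y'" for x y x' y'
    using that by (simp add: p.add)
  have scale_E: "p (scale c x) = p (scale c x')" if "p x = p x'" for c x x'
    using that by (simp add: p.scale)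
  have dim_ker_E: "dim {x \<in> E. p x = p 0} = dim {x' \<in> E. p 0 = p x'}"
    by (simp add: p.zero eq_commute[of 0])
  have total_E: "\<exists>x' \<in> E. p x = p x'" "\<exists>x' \<in> E. p x' = p x" if "x \<in> E" for x
    using that by auto
  \<comment> \<open>Its extensions to \<open>E\<close> over \<open>p\<close> and to \<open>G\<close> over \<open>f\<close>.\<close>
  obtain r2 where r2: "endo scale r2" "\<And>x. x \<in> E \<inter> G \<Longrightarrow> r2 x = r1 x" "bij_betw r2 E E"
    "\<And>x. x \<in> E \<Longrightarrow> p x = p (r2 x)"
    by (rule lift_isomorphism[where R = "\<lambda>x x'. p x = p x'", OF refl sum_E scale_E E(1) E(1) W(2)
          sub(1) sub(1) total_E dim_ker_E r1(1) EG(1) Int_lower1 r1_inj r1_img(1)])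
      (simp_all add: r1_eq)
  have sum_G: "f (x + y) = f' (x' + y')" if "f x = f' x'" "f y = f' y'" for x y x' y'
    using that by (simp add: f.add f'.add)
  have scale_G: "f (scale c x) = f' (scale c x')" if "f x = f' x'" for c x x'
    using that by (simp add: f.scale f'.scale)
  have zero_G: "f 0 = f' 0" by (simp add: f.zero f'.zero)
  have dim_ker_G: "dim {x \<in> G. f x = f' 0} = dim {x' \<in> G'. f 0 = f' x'}"
    using dim_G by (simp add: f.zero f'.zero eq_commute[of 0])
  have total_G: "\<exists>x' \<in> G'. f x = f' x'" if "x \<in> G" for x
    using that im by (metis imageE imageI)
  have total_G': "\<exists>x \<in> G. f x = f' x'" if "x' \<in> G'" for x'
    using that im by (metis imageE imageI)
  obtain r3 where r3: "endo scale r3" "\<And>x. x \<in> E \<inter> G \<Longrightarrow> r3 x = r1 x" "bij_betw r3 G G'"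
    "\<And>x. x \<in> G \<Longrightarrow> f x = f' (r3 x)"
    by (rule lift_isomorphism[where R = "\<lambda>x x'. f x = f' x'", OF zero_G sum_G scale_G G(1) G'(1) W(2)
          sub(2) sub(3) total_G total_G' dim_ker_G r1(1) EG(1) Int_lower2 r1_inj r1_img(2)])
      (simp_all add: r1_eq)
  obtain r4 where r4: "endo scale r4" "\<And>x. x \<in> E \<Longrightarrow> r4 x = r2 x" "\<And>x. x \<in> G \<Longrightarrow> r4 x = r3 x"
    using glue_linear[OF r2(1) r3(1) E(1) G(1)] r2(2) r3(2) by auto
  interpret r4: Vector_Spaces.linear scale scale r4 by (rule r4(1))
  have r4E: "bij_betw r4 E E" using r2(3) r4(2) by (subst bij_betw_cong[of _ _ r2]) auto
  have r4G: "bij_betw r4 G G'" using r3(3) r4(3) by (subst bij_betw_cong[of _ _ r3]) auto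
  have span_EG: "span (E \<union> G) = {x + y |x y. x \<in> E \<and> y \<in> G}"
    using E(1) G(1) by (simp add: span_Un span_eq_iff[THEN iffD2])
  \<comment> \<open>A relation \<open>r4 x = r4 (- y)\<close> with \<open>x \<in> E\<close>, \<open>- y \<in> G\<close> lies in \<open>E \<inter> G'\<close>, hence comes from \<open>E \<inter> G\<close>.\<close>
  have inj: "inj_on r4 (span (E \<union> G))"
    unfolding r4.inj_on_iff_eq_0[OF subspace_span]
  proof (intro ballI impI)
    fix z assume "z \<in> span (E \<union> G)" and z0: "r4 z = 0"
    then obtain x y where xy: "x \<in> E" "y \<in> G" "z = x + y" by (auto simp: span_EG)
    with z0 have neg: "r4 x = r4 (- y)" by (simp add: r4.add r4.neg eq_neg_iff_add_eq_0)
    have "- y \<in> G" using G(1) xy(2) by (rule subspace_neg)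
    then have "r4 x \<in> E \<inter> G'"
      using neg xy(1) r4E r4G by (metis IntI bij_betwE)
    then obtain w where w: "w \<in> E \<inter> G" "r4 x = r1 w"
      using r1_onto by blast
    then have "r4 x = r4 w" using r4(2) r2(2) by simp
    then have "x = w" using r4E xy(1) w(1) by (auto simp: bij_betw_def dest: inj_onD)
    then have "x \<in> G" using w(1) by blast
    then have "x = - y" using neg r4G \<open>- y \<in> G\<close> by (auto simp: bij_betw_def dest: inj_onD)
    then show "z = 0" using xy(3) by simp
  qed
  have EGW: "span (E \<union> G) \<subseteq> W" using E(2) G(2) W(1) by (intro span_minimal) auto
  have imgW: "r4 ` span (E \<union> G) \<subseteq> W"
  proof -
    have "r4 ` (E \<union> G) \<subseteq> W" using r4E r4G E(2) G'(2) by (auto simp: bij_betw_def)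
    then have "span (r4 ` (E \<union> G)) \<subseteq> W" using W(1) by (rule span_minimal)
    then show ?thesis by (simp add: r4.span_image)
  qed
  obtain r where r: "endo scale r" "\<And>x. x \<in> span (E \<union> G) \<Longrightarrow> r x = r4 x" "bij_betw r W W"
    using extend_isomorphism[OF r4(1) subspace_span EGW W(1) W(1) inj imgW W(2,3) W(2,3) refl] by blast
  have rE: "r x = r2 x" if "x \<in> E" for x using that r(2) r4(2) by (simp add: span_base)
  have rG: "r x = r3 x" if "x \<in> G" for x using that r(2) r4(3) by (simp add: span_base)
  show thesis
  proof (rule that[OF r(1) r(3)])
    show "bij_betw r E E" using r2(3) rE by (subst bij_betw_cong[of _ _ r2]) auto
    show "bij_betw r G G'" using r3(3) rG by (subst bij_betw_cong[of _ _ r3]) auto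
  qed (simp_all add: rE rG r2(4)[symmetric] r3(4)[symmetric])
qed

end

section \<open>Matrices acting on a finite window\<close>

abbreviation box :: "int \<Rightarrow> (int \<Rightarrow> 'k::field) set"
  where "box N \<equiv> supported_on {-N..N}"

definition restr :: "int set \<Rightarrow> (int \<Rightarrow> 'k::field) \<Rightarrow> int \<Rightarrow> 'k"
  where "restr J v = (\<lambda>i. if i \<in> J then v i else 0)"

lemma restr_apply [simp]: "restr J v i = (if i \<in> J then v i else 0)"
  by (simp add: restr_def)

lemma linear_restr: "endo col_scale (restr J)"
  by unfold_locales (auto simp: col_scale_def fun_eq_iff)

lemma restr_supported_on:
  assumes "v \<in> fin_columns" shows "restr J v \<in> supported_on J"
proof -
  have "{j. restr J v j \<noteq> 0} \<subseteq> {j. v j \<noteq> 0}" by auto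
  with assms have "restr J v \<in> fin_columns"
    unfolding fin_columns_def by (blast intro: finite_subset)
  then show ?thesis by (simp add: supported_on_def)
qed

lemma supported_on_iff: "v \<in> supported_on J \<longleftrightarrow> v \<in> fin_columns \<and> (\<forall>i. i \<notin> J \<longrightarrow> v i = 0)"
  by (auto simp: supported_on_def)

lemma supported_on_mono: "J \<subseteq> J' \<Longrightarrow> supported_on J \<subseteq> supported_on J'"
  by (auto simp: supported_on_def)

lemma fin_columns_add: "v \<in> fin_columns \<Longrightarrow> w \<in> fin_columns \<Longrightarrow> v + w \<in> fin_columns"
  using col.subspace_add[OF subspace_supported_on, of v UNIV w] by (simp add: supported_on_iff)

lemma fin_columns_diff: "v \<in> fin_columns \<Longrightarrow> w \<in> fin_columns \<Longrightarrow> v - w \<in> fin_columns"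
  using col.subspace_diff[OF subspace_supported_on, of v UNIV w] by (simp add: supported_on_iff)

lemma restr_minus_plus_mid:
  assumes "\<alpha> \<in> index_pairs" "v \<in> supported_on {..snd \<alpha>}"
  shows "restr (minus_idx \<alpha>) v + restr (mid_idx \<alpha>) v = v"
  using assms by (auto simp: fun_eq_iff supported_on_iff minus_idx_def mid_idx_def index_pairs_def)

lemma matrix_eqI: "(\<And>j. mat_vec g (unit_col j) = mat_vec h (unit_col j)) \<Longrightarrow> g = h"
  by (simp add: mat_vec_unit_col fun_eq_iff)

lemma window_fixes_outside:
  assumes "window N g" "\<And>i. \<bar>i\<bar> \<le> N \<Longrightarrow> v i = 0"
  shows "mat_vec g v = v"
proof
  fix i
  have "g i l * v l = mat_one i l * v l" for l
    using assms by (cases "\<bar>l\<bar> \<le> N") (auto simp: window_def)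
  then have "(\<lambda>l. g i l * v l) = (\<lambda>l. mat_one i l * v l)" by blast
  then show "mat_vec g v i = v i" by (simp only: mat_vec_def Sum_any_delta_left)
qed

lemma window_mat_vec_box:
  assumes "window N g" "v \<in> box N"
  shows "mat_vec g v \<in> box N"
proof -
  have "mat_vec g v i = 0" if "\<bar>i\<bar> > N" for i
  proof -
    have "mat_vec g v i = v i"
      using assms(1) that by (simp add: mat_vec_def window_def Sum_any_delta_left)
    moreover have "i \<notin> {-N..N}" using that by auto
    ultimately show ?thesis using assms(2) by (auto simp only: supported_on_iff)
  qed
  then show ?thesis
    using assms fin_mat_vec[OF assms(1)] by (auto simp: supported_on_iff)
qed

definition matrix_on :: "int \<Rightarrow> ((int \<Rightarrow> 'k::field) \<Rightarrow> int \<Rightarrow> 'k) \<Rightarrow> int \<Rightarrow> int \<Rightarrow> 'k"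
  where "matrix_on N r i j = (if \<bar>j\<bar> \<le> N then r (unit_col j) i else mat_one i j)"

lemma unit_col_box: "\<bar>j\<bar> \<le> N \<Longrightarrow> unit_col j \<in> box N"
  by (rule unit_col_supported_on) auto

lemma window_matrix_on:
  assumes "r ` box N \<subseteq> box N"
  shows "window N (matrix_on N r)"
proof -
  have "r (unit_col j) i = 0" if "\<bar>j\<bar> \<le> N" "\<bar>i\<bar> > N" for i j
  proof -
    have "r (unit_col j) \<in> box N" using assms unit_col_box[OF that(1)] by blast
    moreover have "i \<notin> {-N..N}" using that(2) by auto
    ultimately show ?thesis by (auto simp only: supported_on_iff)
  qed
  then show ?thesis by (auto simp: window_def matrix_on_def mat_one_def)
qed

lemma mat_vec_matrix_on:
  fixes r :: "(int \<Rightarrow> 'k::field) \<Rightarrow> int \<Rightarrow> 'k"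
  assumes r: "endo col_scale r" "r ` box N \<subseteq> box N" and x: "x \<in> box N"
  shows "mat_vec (matrix_on N r) x = r x"
proof -
  interpret vector_space_pair "col_scale :: 'k \<Rightarrow> _" col_scale by unfold_locales
  show ?thesis
  proof (rule linear_eq_on[OF linear_mat_vec[OF window_matrix_on[OF r(2)]] r(1)])
    show "x \<in> col.span (unit_col ` {-N..N})" using x by (simp add: span_unit_col)
    show "mat_vec (matrix_on N r) b = r b" if "b \<in> unit_col ` {-N..N}" for b
      using that by (auto simp: mat_vec_unit_col matrix_on_def fun_eq_iff)
  qed
qed

lemma matrix_on_left_inverse:
  fixes r s :: "(int \<Rightarrow> 'k::field) \<Rightarrow> int \<Rightarrow> 'k"
  assumes r: "endo col_scale r" "r ` box N \<subseteq> box N" and s: "endo col_scale s" "s ` box N \<subseteq> box N"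
    and sr: "\<And>x. x \<in> box N \<Longrightarrow> s (r x) = x"
  shows "mat_mult (matrix_on N s) (matrix_on N r) = mat_one"
proof (rule matrix_eqI)
  fix j
  note w = window_matrix_on[OF s(2)] window_matrix_on[OF r(2)]
  have "mat_vec (mat_mult (matrix_on N s) (matrix_on N r)) (unit_col j)
      = mat_vec (matrix_on N s) (mat_vec (matrix_on N r) (unit_col j))"
    by (rule mat_vec_mult[OF w unit_col_fin])
  also have "\<dots> = unit_col j"
  proof (cases "\<bar>j\<bar> \<le> N")
    case True
    then have "(unit_col j :: int \<Rightarrow> 'k) \<in> box N" "r (unit_col j) \<in> box N" using unit_col_box r(2) by blast+
    then show ?thesis using mat_vec_matrix_on[OF r] mat_vec_matrix_on[OF s] sr by simp
  next
    case False
    then have "(unit_col j :: int \<Rightarrow> 'k) i = 0" if "\<bar>i\<bar> \<le> N" for i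
      using that by (auto simp: unit_col_def mat_one_def)
    then show ?thesis using w by (simp add: window_fixes_outside)
  qed
  finally show "mat_vec (mat_mult (matrix_on N s) (matrix_on N r)) (unit_col j)
      = mat_vec mat_one (unit_col j)" by simp
qed

lemma matrix_on_GL2inf:
  fixes r :: "(int \<Rightarrow> 'k::field) \<Rightarrow> int \<Rightarrow> 'k"
  assumes r: "endo col_scale r" "bij_betw r (box N) (box N)"
  shows "matrix_on N r \<in> carrier GL2inf"
proof -
  interpret vector_space_pair "col_scale :: 'k \<Rightarrow> _" col_scale by unfold_locales
  have inj: "inj_on r (box N)" and img: "r ` box N = box N" using r(2) by (auto simp: bij_betw_def)
  obtain s where s: "endo col_scale s" "\<forall>x \<in> box N. s (r x) = x"
    using linear_exists_left_inverse_on[OF r(1) subspace_supported_on inj] by blast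
  have s_img: "s y \<in> box N \<and> r (s y) = y" if "y \<in> box N" for y
  proof -
    have "y \<in> r ` box N" using that img by simp
    then obtain x where "y = r x" "x \<in> box N" by (rule imageE)
    then show ?thesis using s(2) by simp
  qed
  have rb: "r ` box N \<subseteq> box N" using img by simp
  have sb: "s ` box N \<subseteq> box N" using s_img by blast
  have "mat_mult (matrix_on N r) (matrix_on N s) = mat_one"
    by (rule matrix_on_left_inverse[OF s(1) sb r(1) rb]) (simp add: s_img)
  moreover have "mat_mult (matrix_on N s) (matrix_on N r) = mat_one"
    by (rule matrix_on_left_inverse[OF r(1) rb s(1) sb]) (simp add: s(2))
  ultimately show ?thesis
    using window_matrix_on[OF rb] window_matrix_on[OF sb] by (auto simp: GL2inf_carrier_iff)
qed

text \<open>The block conditions on \<open>g \<in> Q \<alpha>\<close> say that \<open>g\<close> preserves the columns supported on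
  \<open>j \<le> \<alpha>\<^sub>+\<close> together with their middle block; that \<open>k\<^sub>\<alpha>\<^sup>-\<close> is preserved is the case of a
  vanishing middle block.  Unit columns outside the window are fixed anyway.\<close>

lemma Q_memI:
  fixes g :: "int \<Rightarrow> int \<Rightarrow> 'k::field"
  assumes \<alpha>: "\<alpha> \<in> index_pairs" and g: "g \<in> carrier GL2inf" "window N g"
    and stable: "\<And>x. x \<in> box N \<Longrightarrow> x \<in> supported_on {..snd \<alpha>} \<Longrightarrow>
      mat_vec g x \<in> supported_on {..snd \<alpha>} \<and>
      restr (mid_idx \<alpha>) (mat_vec g x) = restr (mid_idx \<alpha>) x"
  shows "g \<in> Q \<alpha>"
proof -
  have low: "g i j = 0" if "j \<le> snd \<alpha>" "snd \<alpha> < i" for i j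
  proof (cases "\<bar>j\<bar> \<le> N")
    case True
    then have "mat_vec g (unit_col j) \<in> supported_on {..snd \<alpha>}"
      using stable[OF unit_col_box[OF True] unit_col_supported_on] that by auto
    then show ?thesis using that by (auto simp: supported_on_iff mat_vec_unit_col)
  next
    case False
    then show ?thesis using g(2) that by (auto simp: window_def mat_one_def)
  qed
  have mid: "g i j = mat_one i j" if "j \<le> snd \<alpha>" "i \<in> mid_idx \<alpha>" for i j
  proof (cases "\<bar>j\<bar> \<le> N")
    case True
    then have "restr (mid_idx \<alpha>) (mat_vec g (unit_col j)) i = restr (mid_idx \<alpha>) (unit_col j) i"
      using stable[OF unit_col_box[OF True] unit_col_supported_on] that by auto
    then show ?thesis using that(2) by (simp only: restr_apply mat_vec_unit_col if_True) (simp add: unit_col_def)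
  next
    case False
    then show ?thesis using g(2) by (auto simp: window_def)
  qed
  have "cut (fst \<alpha>) g"
    unfolding cut_def
  proof (intro allI impI)
    fix i j assume ij: "j \<le> fst \<alpha> \<and> fst \<alpha> < i"
    then have "j \<le> snd \<alpha>" "i \<noteq> j" using \<alpha> by (auto simp: index_pairs_def)
    then show "g i j = 0"
      using low[of j i] mid[of j i] ij by (cases "i \<le> snd \<alpha>") (auto simp: mid_idx_def mat_one_def)
  qed
  then show ?thesis
    using g(1) low mid by (auto simp: Q_iff[OF \<alpha>] cut_def mid_idx_def)
qed

section \<open>The invariants as data of a pair of flags\<close>

text \<open>Columns in \<open>\<chi>\<close> and \<open>\<eta>\<close> may reach arbitrarily far to the left; their part \<open>z\<close> left
  of the window is fixed by \<open>A\<close> and can be dropped without changing the blocks that matter.\<close>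

lemma split_off_far_part:
  fixes w :: "int \<Rightarrow> 'k::field"
  assumes A: "window N A" and w: "w \<in> supported_on {..N}"
  obtains t z where "w = t + z" "t \<in> box N" "\<And>i. -N \<le> i \<Longrightarrow> t i = w i" "\<And>i. i < -N \<Longrightarrow> t i = 0"
    "z \<in> supported_on {..<-N}" "mat_vec A w = mat_vec A t + z"
proof (rule that)
  let ?t = "restr {-N..N} w" and ?z = "restr {..<-N} w"
  have w': "w i = 0" if "N < i" for i using w that by (auto simp: supported_on_iff)
  show wtz: "w = ?t + ?z"
    using w' by (auto simp: fun_eq_iff)
  show "?t \<in> box N" "?z \<in> supported_on {..<-N}"
    using w by (simp_all add: restr_supported_on supported_on_iff[of w])
  show "?t i = w i" if "-N \<le> i" for i
    using w' that by auto
  show "?t i = 0" if "i < -N" for i using that by auto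
  have "mat_vec A ?z = ?z"
    using A by (rule window_fixes_outside) auto
  then show "mat_vec A w = mat_vec A ?t + ?z"
    by (subst wtz) (simp add: mat_vec_add[OF A])
qed

text \<open>The member \<open>G\<close> of the second flag: the preimage under \<open>A\<close> of \<open>k\<^sub>\<alpha>\<^sup>- \<oplus> k\<^sub>\<alpha>\<close>, inside the window.\<close>

definition low_preimage :: "int \<times> int \<Rightarrow> int \<Rightarrow> (int \<Rightarrow> int \<Rightarrow> 'k::field) \<Rightarrow> (int \<Rightarrow> 'k) set"
  where "low_preimage \<alpha> N A = {x \<in> box N. mat_vec A x \<in> supported_on {..snd \<alpha>}}"

lemma subspace_low_preimage:
  assumes "window N A" shows "col.subspace (low_preimage \<alpha> N A)"
proof -
  interpret Vector_Spaces.linear col_scale col_scale "mat_vec A" by (rule linear_mat_vec[OF assms])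
  have "low_preimage \<alpha> N A = box N \<inter> mat_vec A -` supported_on {..snd \<alpha>}"
    by (auto simp: low_preimage_def)
  then show ?thesis
    using col.subspace_inter[OF subspace_supported_on subspace_vimage[OF subspace_supported_on]] by simp
qed

lemma chi_eq_image:
  fixes A :: "int \<Rightarrow> int \<Rightarrow> 'k::field"
  assumes A: "window N A"
    and \<alpha>: "\<alpha> \<in> index_pairs" "-N \<le> fst \<alpha>"
    and \<beta>: "\<beta> \<in> index_pairs" "-N \<le> fst \<beta>" "snd \<beta> \<le> N"
  shows "chi \<alpha> \<beta> A = (\<lambda>x. (restr (mid_idx \<beta>) x, restr (mid_idx \<alpha>) (mat_vec A x))) `
    (supported_on ({-N..N} \<inter> {..snd \<beta>}) \<inter> low_preimage \<alpha> N A)" (is "_ = ?F ` ?D")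
proof (intro subset_antisym subsetI)
  fix q assume "q \<in> ?F ` ?D"
  then obtain x where xD: "x \<in> ?D" and q: "q = ?F x" by blast
  have x: "x \<in> supported_on {..snd \<beta>}" "mat_vec A x \<in> supported_on {..snd \<alpha>}"
    using xD by (simp_all add: low_preimage_def) (simp add: supported_on_iff)
  have fin: "x \<in> fin_columns" "mat_vec A x \<in> fin_columns" using x by (simp_all add: supported_on_iff)
  have "restr (minus_idx \<alpha>) (mat_vec A x) + restr (mid_idx \<alpha>) (mat_vec A x)
      = mat_vec A (restr (minus_idx \<beta>) x + restr (mid_idx \<beta>) x)"
    using x \<alpha>(1) \<beta>(1) by (simp add: restr_minus_plus_mid)
  then show "q \<in> chi \<alpha> \<beta> A"
    unfolding q chi_def using restr_supported_on fin by blast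
next
  fix q assume "q \<in> chi \<alpha> \<beta> A"
  then obtain v u x y where q: "q = (v, u)"
    and v: "v \<in> supported_on (mid_idx \<beta>)" and u: "u \<in> supported_on (mid_idx \<alpha>)"
    and x: "x \<in> supported_on (minus_idx \<alpha>)" and y: "y \<in> supported_on (minus_idx \<beta>)"
    and eq: "x + u = mat_vec A (y + v)"
    by (auto simp: chi_def)
  have yv: "y + v \<in> supported_on {..snd \<beta>}" and xu: "x + u \<in> supported_on {..snd \<alpha>}"
    using v u x y \<alpha>(1) \<beta>(1) fin_columns_add[of y v] fin_columns_add[of x u]
    by (auto simp: supported_on_iff minus_idx_def mid_idx_def index_pairs_def)
  have "y + v \<in> supported_on {..N}" using yv \<beta>(3) by (auto simp: supported_on_iff)
  from split_off_far_part[OF A this] obtain t z where tz: "y + v = t + z" "t \<in> box N"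
    "\<And>i. -N \<le> i \<Longrightarrow> t i = (y + v) i" "\<And>i. i < -N \<Longrightarrow> t i = 0"
    and z: "z \<in> supported_on {..<-N}" and At: "mat_vec A (y + v) = mat_vec A t + z"
    by metis
  have At': "mat_vec A t = x + u - z" using At eq by (simp add: algebra_simps)
  have z0: "z i = 0" if "-N \<le> i" for i using z that by (auto simp: supported_on_iff)
  have "t i = 0" if "snd \<beta> < i" for i
    using tz(3,4)[of i] yv that by (cases "-N \<le> i") (auto simp: supported_on_iff)
  then have "t \<in> supported_on ({-N..N} \<inter> {..snd \<beta>})"
    using tz(2) by (auto simp: supported_on_iff)
  moreover have "mat_vec A t \<in> supported_on {..snd \<alpha>}"
  proof -
    have "(x + u - z) i = 0" if "snd \<alpha> < i" for i
      using xu z0[of i] that \<alpha> by (auto simp: supported_on_iff index_pairs_def)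
    moreover have "x + u - z \<in> fin_columns"
      using xu z by (intro fin_columns_diff) (simp_all add: supported_on_iff)
    ultimately show ?thesis unfolding At' supported_on_iff by auto
  qed
  ultimately have "t \<in> ?D" using tz(2) by (simp add: low_preimage_def)
  moreover have "restr (mid_idx \<beta>) t = v"
  proof
    fix i show "restr (mid_idx \<beta>) t i = v i"
      using v y tz(3)[of i] \<beta> by (auto simp: supported_on_iff mid_idx_def minus_idx_def)
  qed
  moreover have "restr (mid_idx \<alpha>) (mat_vec A t) = u"
  proof
    fix i show "restr (mid_idx \<alpha>) (mat_vec A t) i = u i"
      using u x z0[of i] \<alpha> by (auto simp: At' supported_on_iff mid_idx_def minus_idx_def)
  qed
  ultimately show "q \<in> ?F ` ?D" unfolding q by blast
qed

lemma eta_eq_dim_image: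
  fixes A :: "int \<Rightarrow> int \<Rightarrow> 'k::field"
  assumes A: "window N A"
    and \<alpha>: "\<alpha> \<in> index_pairs" "-N \<le> fst \<alpha>" and \<beta>: "\<beta> \<in> index_pairs" "snd \<beta> \<le> N"
  shows "eta \<alpha> \<beta> A = col.dim ((\<lambda>x. restr (plus_idx \<alpha>) (mat_vec A x)) `
    supported_on ({-N..N} \<inter> minus_idx \<beta>))" (is "_ = col.dim (?h ` ?D)")
proof -
  have h: "endo col_scale ?h"
    using Vector_Spaces.linear_compose[OF linear_mat_vec[OF A] linear_restr] by (simp add: o_def)
  interpret h: Vector_Spaces.linear col_scale col_scale ?h by (rule h)
  have "(\<lambda>j i. if i \<in> plus_idx \<alpha> then A i j else 0) ` minus_idx \<beta> = ?h ` unit_col ` minus_idx \<beta>"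
    by (simp only: image_image mat_vec_unit_col restr_def)
  then have "eta \<alpha> \<beta> A = col.dim (col.span (?h ` unit_col ` minus_idx \<beta>))"
    by (simp add: eta_def block_rank_def)
  also have "col.span (?h ` unit_col ` minus_idx \<beta>) = ?h ` supported_on (minus_idx \<beta>)"
    by (simp add: h.span_image span_unit_col)
  also have "\<dots> = ?h ` ?D"
  proof (intro subset_antisym subsetI)
    fix c assume "c \<in> ?h ` supported_on (minus_idx \<beta>)"
    then obtain w where w: "w \<in> supported_on (minus_idx \<beta>)" "c = ?h w" by blast
    then have "w \<in> supported_on {..N}" using \<beta> by (auto simp: supported_on_iff minus_idx_def index_pairs_def)
    from split_off_far_part[OF A this] obtain t z where tz: "w = t + z" "t \<in> box N"
      "\<And>i. -N \<le> i \<Longrightarrow> t i = w i" "\<And>i. i < -N \<Longrightarrow> t i = 0"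
      and z: "z \<in> supported_on {..<-N}" and At: "mat_vec A w = mat_vec A t + z"
      by metis
    have "t i = 0" if "i \<notin> minus_idx \<beta>" for i
      using tz(3,4)[of i] w(1) that by (cases "-N \<le> i") (auto simp: supported_on_iff)
    then have "t \<in> ?D" using tz(2) by (auto simp: supported_on_iff)
    moreover have "?h w = ?h t"
    proof
      fix i
      have "z i = 0" if "i \<in> plus_idx \<alpha>"
        using z that \<alpha> by (auto simp: supported_on_iff plus_idx_def index_pairs_def)
      then show "?h w i = ?h t i" by (simp add: At)
    qed
    ultimately show "c \<in> ?h ` ?D" using w(2) by blast
  qed (use supported_on_mono[of "{-N..N} \<inter> minus_idx \<beta>" "minus_idx \<beta>"] in blast)
  finally show ?thesis .
qed

lemma mid_image_low_preimage:
  fixes A :: "int \<Rightarrow> int \<Rightarrow> 'k::field"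
  assumes A: "window N A" "window N h" "mat_mult A h = mat_one"
    and \<alpha>: "\<alpha> \<in> index_pairs" "-N \<le> fst \<alpha>" "snd \<alpha> \<le> N"
  shows "(\<lambda>x. restr (mid_idx \<alpha>) (mat_vec A x)) ` low_preimage \<alpha> N A = supported_on (mid_idx \<alpha>)"
proof (intro subset_antisym subsetI)
  fix u :: "int \<Rightarrow> 'k" assume u: "u \<in> supported_on (mid_idx \<alpha>)"
  then have ub: "u \<in> box N" "u \<in> supported_on {..snd \<alpha>}" and fin: "u \<in> fin_columns"
    using \<alpha> by (auto simp: supported_on_iff mid_idx_def)
  have Ah: "mat_vec A (mat_vec h u) = u"
    using mat_vec_mult[OF A(1,2) fin] A(3) by simp
  have "mat_vec h u \<in> low_preimage \<alpha> N A"
    using window_mat_vec_box[OF A(2) ub(1)] ub(2) Ah by (simp add: low_preimage_def)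
  moreover have "restr (mid_idx \<alpha>) (mat_vec A (mat_vec h u)) = u"
    using u unfolding Ah by (auto simp: fun_eq_iff supported_on_iff)
  ultimately show "u \<in> (\<lambda>x. restr (mid_idx \<alpha>) (mat_vec A x)) ` low_preimage \<alpha> N A"
    by (metis (no_types, lifting) imageI)
next
  fix u assume "u \<in> (\<lambda>x. restr (mid_idx \<alpha>) (mat_vec A x)) ` low_preimage \<alpha> N A"
  then show "u \<in> supported_on (mid_idx \<alpha>)"
    by (auto simp: low_preimage_def supported_on_iff[of _ "{..snd \<alpha>}"] intro!: restr_supported_on)
qed

text \<open>\<open>A\<close> maps the smaller member of the second flag isomorphically onto the part of \<open>k\<^sub>\<alpha>\<^sup>-\<close> in
  the window.  The dimension is thus independent of \<open>A\<close>, which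
  reflects that finite perturbations of the identity have index zero.\<close>

lemma dim_kernel_low_preimage:
  fixes A :: "int \<Rightarrow> int \<Rightarrow> 'k::field"
  assumes A: "window N A" "window N h" "mat_mult A h = mat_one" "mat_mult h A = mat_one"
    and \<alpha>: "\<alpha> \<in> index_pairs"
  shows "col.dim {x \<in> low_preimage \<alpha> N A. restr (mid_idx \<alpha>) (mat_vec A x) = 0}
    = col.dim (supported_on ({-N..N} \<inter> minus_idx \<alpha>) :: (int \<Rightarrow> 'k) set)" (is "col.dim ?G = col.dim ?M")
proof -
  note Alin = linear_mat_vec[OF A(1)] and hlin = linear_mat_vec[OF A(2)]
  have hA: "mat_vec h (mat_vec A x) = x" and Ah: "mat_vec A (mat_vec h x) = x" if "x \<in> fin_columns" for x
    using mat_vec_mult[OF A(2,1) that] mat_vec_mult[OF A(1,2) that] A(3,4) by simp_all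
  interpret h: Vector_Spaces.linear col_scale col_scale "mat_vec h" by (rule hlin)
  have "?G = mat_vec h ` ?M"
  proof (intro subset_antisym subsetI)
    fix x assume x: "x \<in> ?G"
    then have xb: "x \<in> box N" by (simp add: low_preimage_def)
    have z: "mat_vec A x i = 0" if "i \<notin> minus_idx \<alpha>" for i
    proof (cases "i \<in> mid_idx \<alpha>")
      case True
      then show ?thesis using x by (auto simp: fun_eq_iff split: if_splits)
    next
      case False
      then show ?thesis
        using x that \<alpha> by (auto simp: low_preimage_def supported_on_iff minus_idx_def mid_idx_def)
    qed
    then have "mat_vec A x \<in> ?M"
      using window_mat_vec_box[OF A(1) xb] by (auto simp: supported_on_iff)
    moreover have "x = mat_vec h (mat_vec A x)" using hA xb by (simp add: supported_on_iff)
    ultimately show "x \<in> mat_vec h ` ?M" by blast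
  next
    fix x assume "x \<in> mat_vec h ` ?M"
    then obtain m where m: "m \<in> ?M" "x = mat_vec h m" by blast
    then have mb: "m \<in> box N" and Ax: "mat_vec A x = m" using Ah by (auto simp: supported_on_iff)
    have "m \<in> supported_on {..snd \<alpha>}" "restr (mid_idx \<alpha>) m = 0"
      using m(1) \<alpha> by (auto simp: supported_on_iff fun_eq_iff minus_idx_def mid_idx_def index_pairs_def)
    then show "x \<in> ?G"
      using window_mat_vec_box[OF A(2) mb] m(2) Ax by (simp add: low_preimage_def)
  qed
  moreover have "col.dim ?M = col.dim {x \<in> ?M. mat_vec h x = 0} + col.dim (mat_vec h ` ?M)"
    by (rule col.dim_kernel_plus_image[OF hlin subspace_supported_on, of "unit_col ` ({-N..N} \<inter> minus_idx \<alpha>)"])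
      (simp_all add: span_unit_col)
  moreover have "{x \<in> ?M. mat_vec h x = 0} = {0}"
  proof (intro subset_antisym subsetI)
    fix x assume "x \<in> {x \<in> ?M. mat_vec h x = 0}"
    then have "x = mat_vec A 0" using Ah[of x] by (simp add: supported_on_iff)
    moreover have "mat_vec A 0 = 0" by (simp add: mat_vec_def fun_eq_iff)
    ultimately show "x \<in> {0}" by simp
  qed (simp add: supported_on_iff h.zero fin_columns_def)
  moreover have "col.dim {0 :: int \<Rightarrow> 'k} = 0"
    using col.dim_le_card[of "{0}" "{}"] by simp
  ultimately show ?thesis by simp
qed

text \<open>The block \<open>a\<^sub>3\<^sub>1\<close> is the map sending \<open>x \<in> k\<^sub>\<beta>\<^sup>-\<close> to the plus block of \<open>A x\<close>; its kernel is
  the intersection of \<open>k\<^sub>\<beta>\<^sup>-\<close> with \<open>low_preimage\<close>, so this is rank-nullity.\<close>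

lemma dim_kernel_low_plus_eta:
  fixes A :: "int \<Rightarrow> int \<Rightarrow> 'k::field"
  assumes A: "window N A"
    and \<alpha>: "\<alpha> \<in> index_pairs" "-N \<le> fst \<alpha>" and \<beta>: "\<beta> \<in> index_pairs" "snd \<beta> \<le> N"
  shows "col.dim {x \<in> supported_on ({-N..N} \<inter> {..snd \<beta>}) \<inter> low_preimage \<alpha> N A. restr (mid_idx \<beta>) x = 0}
      + eta \<alpha> \<beta> A = col.dim (supported_on ({-N..N} \<inter> minus_idx \<beta>) :: (int \<Rightarrow> 'k) set)"
    (is "col.dim ?K + _ = col.dim ?D")
proof -
  let ?h = "\<lambda>x. restr (plus_idx \<alpha>) (mat_vec A x)"
  have h: "endo col_scale ?h"
    using Vector_Spaces.linear_compose[OF linear_mat_vec[OF A] linear_restr] by (simp add: o_def)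
  have 1: "x \<in> supported_on ({-N..N} \<inter> {..snd \<beta>}) \<and> restr (mid_idx \<beta>) x = 0 \<longleftrightarrow> x \<in> ?D" for x
  proof
    assume x: "x \<in> supported_on ({-N..N} \<inter> {..snd \<beta>}) \<and> restr (mid_idx \<beta>) x = 0"
    have "x i = 0" if "i \<notin> minus_idx \<beta>" for i
    proof (cases "i \<in> mid_idx \<beta>")
      case True
      then show ?thesis using x by (auto simp: fun_eq_iff split: if_splits)
    next
      case False
      then show ?thesis
        using x that by (auto simp: supported_on_iff minus_idx_def mid_idx_def)
    qed
    then show "x \<in> ?D" using x by (auto simp: supported_on_iff)
  next
    assume "x \<in> ?D"
    then show "x \<in> supported_on ({-N..N} \<inter> {..snd \<beta>}) \<and> restr (mid_idx \<beta>) x = 0"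
      using \<beta> by (auto simp: supported_on_iff fun_eq_iff minus_idx_def mid_idx_def index_pairs_def)
  qed
  have 2: "x \<in> low_preimage \<alpha> N A \<longleftrightarrow> ?h x = 0" if "x \<in> ?D" for x
  proof -
    have x: "x \<in> box N" "mat_vec A x \<in> fin_columns"
      using that fin_mat_vec[OF A] by (auto simp: supported_on_iff)
    then have "x \<in> low_preimage \<alpha> N A \<longleftrightarrow> (\<forall>i \<in> plus_idx \<alpha>. mat_vec A x i = 0)"
      by (auto simp: low_preimage_def supported_on_iff[of "mat_vec A x"] plus_idx_def)
    also have "\<dots> \<longleftrightarrow> ?h x = 0" by (auto simp: fun_eq_iff)
    finally show ?thesis .
  qed
  have "?K = {x \<in> ?D. ?h x = 0}" using 1 2 by auto
  moreover have "col.dim ?D = col.dim {x \<in> ?D. ?h x = 0} + col.dim (?h ` ?D)"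
    by (rule col.dim_kernel_plus_image[OF h subspace_supported_on, of "unit_col ` ({-N..N} \<inter> minus_idx \<beta>)"])
      (simp_all add: span_unit_col)
  ultimately show ?thesis using eta_eq_dim_image[OF A \<alpha> \<beta>] by simp
qed

section \<open>Classification of double cosets\<close>

lemma GL2inf_common_window:
  assumes "A \<in> carrier GL2inf"
  obtains n h where "\<And>N. n \<le> N \<Longrightarrow> window N A" "\<And>N. n \<le> N \<Longrightarrow> window N h"
    "mat_mult A h = mat_one" "mat_mult h A = mat_one"
proof -
  obtain n h where "window n A" "window n h" "mat_mult A h = mat_one" "mat_mult h A = mat_one"
    using assms by (auto simp: GL2inf_carrier_iff)
  then show thesis using that[of n h] by (blast intro: window_mono)
qed

text \<open>With \<open>M\<close> the matrix of the isomorphism of flag pairs, \<open>A' = q A M\<inverse>\<close> for \<open>q = A' M A\<inverse>\<close>;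
  the properties of the isomorphism on the two flags put \<open>M\<close> into \<open>Q \<beta>\<close> and \<open>q\<close> into \<open>Q \<alpha>\<close>.\<close>

lemma same_double_coset:
  fixes A A' :: "int \<Rightarrow> int \<Rightarrow> 'k::field"
  assumes \<alpha>: "\<alpha> \<in> index_pairs" and \<beta>: "\<beta> \<in> index_pairs"
    and A: "A \<in> carrier GL2inf" and A': "A' \<in> carrier GL2inf"
    and chi: "chi \<alpha> \<beta> A = chi \<alpha> \<beta> A'" and eta: "eta \<alpha> \<beta> A = eta \<alpha> \<beta> A'"
  shows "A' \<in> double_coset \<alpha> \<beta> A"
proof -
  interpret group "GL2inf :: (int \<Rightarrow> int \<Rightarrow> 'k) monoid" by (rule group_GL2inf)
  obtain n h where n: "\<And>N. n \<le> N \<Longrightarrow> window N A" "\<And>N. n \<le> N \<Longrightarrow> window N h"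
    and h: "mat_mult A h = mat_one" "mat_mult h A = mat_one"
    using GL2inf_common_window[OF A] by metis
  obtain n' h' where n': "\<And>N. n' \<le> N \<Longrightarrow> window N A'" "\<And>N. n' \<le> N \<Longrightarrow> window N h'"
    and h': "mat_mult A' h' = mat_one" "mat_mult h' A' = mat_one"
    using GL2inf_common_window[OF A'] by metis
  define N where "N = Max {n, n', - fst \<alpha>, snd \<alpha>, - fst \<beta>, snd \<beta>}"
  have N: "n \<le> N" "n' \<le> N" "- fst \<alpha> \<le> N" "snd \<alpha> \<le> N" "- fst \<beta> \<le> N" "snd \<beta> \<le> N"
    unfolding N_def by (simp_all add: Max_ge)
  have N\<alpha>: "- N \<le> fst \<alpha>" and N\<beta>: "- N \<le> fst \<beta>" using N by linarith+
  note w = n[OF N(1)] and w' = n'[OF N(2)]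
  let ?E = "supported_on ({-N..N} \<inter> {..snd \<beta>}) :: (int \<Rightarrow> 'k) set"
  let ?G = "low_preimage \<alpha> N"
  let ?p = "restr (mid_idx \<beta>)"
  let ?f = "\<lambda>A x. restr (mid_idx \<alpha>) (mat_vec A x)"
  have f: "endo col_scale (?f B)" if "window N B" for B
    using Vector_Spaces.linear_compose[OF linear_mat_vec[OF that] linear_restr] by (simp add: o_def)
  have rel: "(\<lambda>x. (?p x, ?f A x)) ` (?E \<inter> ?G A) = (\<lambda>x. (?p x, ?f A' x)) ` (?E \<inter> ?G A')"
    using chi chi_eq_image[OF w(1) \<alpha> N\<alpha> \<beta> N\<beta> N(6)] chi_eq_image[OF w'(1) \<alpha> N\<alpha> \<beta> N\<beta> N(6)]
    by simp
  have im: "?f A ` ?G A = ?f A' ` ?G A'"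
    using mid_image_low_preimage[OF w h(1) \<alpha> N\<alpha> N(4)] mid_image_low_preimage[OF w' h'(1) \<alpha> N\<alpha> N(4)]
    by simp
  have dim_G: "col.dim {x \<in> ?G A. ?f A x = 0} = col.dim {x \<in> ?G A'. ?f A' x = 0}"
    using dim_kernel_low_preimage[OF w h \<alpha>] dim_kernel_low_preimage[OF w' h' \<alpha>] by simp
  have dim_E: "col.dim {x \<in> ?E \<inter> ?G A. ?p x = 0} = col.dim {x \<in> ?E \<inter> ?G A'. ?p x = 0}"
    using dim_kernel_low_plus_eta[OF w(1) \<alpha> N\<alpha> \<beta> N(6)] dim_kernel_low_plus_eta[OF w'(1) \<alpha> N\<alpha> \<beta> N(6)] eta
    by simp
  have sub: "?E \<subseteq> box N" "?G A \<subseteq> box N" "?G A' \<subseteq> box N"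
    by (auto simp: low_preimage_def supported_on_iff)
  have fin: "finite (unit_col ` {-N..N} :: (int \<Rightarrow> 'k) set)" by simp
  have span: "(box N :: (int \<Rightarrow> 'k) set) \<subseteq> col.span (unit_col ` {-N..N})" by (simp add: span_unit_col)
  obtain r where r: "endo col_scale r" "bij_betw r (box N) (box N)" "bij_betw r ?E ?E"
    "bij_betw r (?G A) (?G A')"
    and rp: "\<And>x. x \<in> ?E \<Longrightarrow> ?p (r x) = ?p x" and rf: "\<And>x. x \<in> ?G A \<Longrightarrow> ?f A' (r x) = ?f A x"
    by (rule col.flag_pair_isomorphism[OF linear_restr f[OF w(1)] f[OF w'(1)] subspace_supported_on fin span
          subspace_supported_on sub(1) subspace_low_preimage[OF w(1)] sub(2)
          subspace_low_preimage[OF w'(1)] sub(3) rel im dim_G dim_E], rule that) assumption+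
  define M where "M = matrix_on N r"
  have M: "M \<in> carrier GL2inf" unfolding M_def by (rule matrix_on_GL2inf[OF r(1,2)])
  have rb: "r ` box N \<subseteq> box N" using r(2) by (simp add: bij_betw_def)
  have wM: "window N M" unfolding M_def using rb by (rule window_matrix_on)
  have Mx: "mat_vec M x = r x" if "x \<in> box N" for x
    unfolding M_def using r(1) rb that by (rule mat_vec_matrix_on)
  have MQ: "M \<in> Q \<beta>"
  proof (rule Q_memI[OF \<beta> M wM])
    fix x :: "int \<Rightarrow> 'k" assume x: "x \<in> box N" "x \<in> supported_on {..snd \<beta>}"
    then have xE: "x \<in> ?E" by (auto simp: supported_on_iff)
    then have "r x \<in> ?E" using r(3) by (rule bij_betwE[THEN bspec, rotated])
    then show "mat_vec M x \<in> supported_on {..snd \<beta>} \<and> ?p (mat_vec M x) = ?p x"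
      using rp[OF xE] Mx[OF x(1)] by (auto simp: supported_on_iff)
  qed
  define q where "q = mat_mult A' (mat_mult M h)"
  have hc: "h \<in> carrier GL2inf" using w h by (auto simp: GL2inf_carrier_iff)
  have wMh: "window N (mat_mult M h)" using wM w(2) by (rule window_mult)
  have qc: "q \<in> carrier GL2inf" using m_closed[OF A' m_closed[OF M hc]] by (simp add: q_def)
  have qQ: "q \<in> Q \<alpha>"
  proof (rule Q_memI[OF \<alpha> qc])
    show "window N q" unfolding q_def using w'(1) wMh by (rule window_mult)
    fix y :: "int \<Rightarrow> 'k" assume y: "y \<in> box N" "y \<in> supported_on {..snd \<alpha>}"
    then have fin: "y \<in> fin_columns" by (simp add: supported_on_iff)
    let ?x = "mat_vec h y"
    have Ax: "mat_vec A ?x = y" using mat_vec_mult[OF w fin] h(1) by simp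
    have xb: "?x \<in> box N" using w(2) y(1) by (rule window_mat_vec_box)
    then have xG: "?x \<in> ?G A" using Ax y(2) by (simp add: low_preimage_def)
    then have "r ?x \<in> ?G A'" using r(4) by (rule bij_betwE[THEN bspec, rotated])
    moreover have "mat_vec q y = mat_vec A' (r ?x)"
      unfolding q_def using mat_vec_mult[OF w'(1) wMh fin] mat_vec_mult[OF wM w(2) fin] Mx[OF xb] by simp
    ultimately show "mat_vec q y \<in> supported_on {..snd \<alpha>} \<and>
        restr (mid_idx \<alpha>) (mat_vec q y) = restr (mid_idx \<alpha>) y"
      using rf[OF xG] Ax by (simp add: low_preimage_def)
  qed
  let ?M = "inv\<^bsub>GL2inf\<^esub> M"
  have "q \<otimes>\<^bsub>GL2inf\<^esub> (A \<otimes>\<^bsub>GL2inf\<^esub> ?M) = A' \<otimes>\<^bsub>GL2inf\<^esub> (M \<otimes>\<^bsub>GL2inf\<^esub> ((h \<otimes>\<^bsub>GL2inf\<^esub> A) \<otimes>\<^bsub>GL2inf\<^esub> ?M))"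
    unfolding q_def GL2inf_simps(1)[symmetric] using A A' M hc by (simp only: m_assoc m_closed inv_closed)
  also have "h \<otimes>\<^bsub>GL2inf\<^esub> A = \<one>\<^bsub>GL2inf\<^esub>" using h by simp
  also have "A' \<otimes>\<^bsub>GL2inf\<^esub> (M \<otimes>\<^bsub>GL2inf\<^esub> (\<one>\<^bsub>GL2inf\<^esub> \<otimes>\<^bsub>GL2inf\<^esub> ?M)) = A'"
    using A' M by (simp only: l_one r_one r_inv inv_closed)
  finally have "A' = mat_mult q (mat_mult A ?M)" by simp
  moreover have "?M \<in> Q \<beta>" using subgroup.m_inv_closed[OF subgroup_Q[OF \<beta>] MQ] .
  ultimately show ?thesis using qQ by (auto simp: double_coset_mem_iff)
qed

lemma double_coset_subset:
  fixes A B :: "int \<Rightarrow> int \<Rightarrow> 'k::field"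
  assumes \<alpha>: "\<alpha> \<in> index_pairs" and \<beta>: "\<beta> \<in> index_pairs"
    and A: "A \<in> carrier GL2inf" and B: "B \<in> double_coset \<alpha> \<beta> A"
  shows "double_coset \<alpha> \<beta> B \<subseteq> double_coset \<alpha> \<beta> A"
proof
  interpret group "GL2inf :: (int \<Rightarrow> int \<Rightarrow> 'k) monoid" by (rule group_GL2inf)
  obtain q r where q: "q \<in> Q \<alpha>" and r: "r \<in> Q \<beta>" and B: "B = mat_mult q (mat_mult A r)"
    using B by (auto simp: double_coset_mem_iff)
  fix C assume "C \<in> double_coset \<alpha> \<beta> B"
  then obtain s t where s: "s \<in> Q \<alpha>" and t: "t \<in> Q \<beta>" and C: "C = mat_mult s (mat_mult B t)"
    by (auto simp: double_coset_mem_iff)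
  have c: "q \<in> carrier GL2inf" "r \<in> carrier GL2inf" "s \<in> carrier GL2inf" "t \<in> carrier GL2inf"
    using q r s t Q_carrier by blast+
  have "C = (s \<otimes>\<^bsub>GL2inf\<^esub> q) \<otimes>\<^bsub>GL2inf\<^esub> (A \<otimes>\<^bsub>GL2inf\<^esub> (r \<otimes>\<^bsub>GL2inf\<^esub> t))"
    unfolding C B GL2inf_simps(1)[symmetric] using c A by (simp only: m_assoc m_closed)
  then show "C \<in> double_coset \<alpha> \<beta> A"
    using subgroup.m_closed[OF subgroup_Q[OF \<alpha>] s q] subgroup.m_closed[OF subgroup_Q[OF \<beta>] r t]
    by (auto simp: double_coset_mem_iff)
qed

theorem theorem1p5:
  fixes \<alpha> \<beta> :: "int \<times> int"
    and \<aa> \<aa>' :: "(int \<Rightarrow> int \<Rightarrow> 'k::field) set"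
  assumes "\<alpha> \<in> index_pairs"
    and "\<beta> \<in> index_pairs"
    and "\<aa> \<in> double_cosets \<alpha> \<beta>"
    and "\<aa>' \<in> double_cosets \<alpha> \<beta>"
    and "chi_coset \<alpha> \<beta> \<aa> = chi_coset \<alpha> \<beta> \<aa>'"
    and "eta_coset \<alpha> \<beta> \<aa> = eta_coset \<alpha> \<beta> \<aa>'"
  shows "\<aa> = \<aa>'"
proof -
  obtain A A' where A: "A \<in> carrier GL2inf" "\<aa> = double_coset \<alpha> \<beta> A"
    and A': "A' \<in> carrier GL2inf" "\<aa>' = double_coset \<alpha> \<beta> A'"
    using assms(3,4) by (auto simp: double_cosets_def)
  have chi: "chi \<alpha> \<beta> A = chi \<alpha> \<beta> A'" and eta: "eta \<alpha> \<beta> A = eta \<alpha> \<beta> A'"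
    using assms A A' by (simp_all add: chi_coset_eq eta_coset_eq)
  have "double_coset \<alpha> \<beta> A' \<subseteq> double_coset \<alpha> \<beta> A"
    using same_double_coset[OF assms(1,2) A(1) A'(1) chi eta] by (rule double_coset_subset[OF assms(1,2) A(1)])
  moreover have "double_coset \<alpha> \<beta> A \<subseteq> double_coset \<alpha> \<beta> A'"
    using same_double_coset[OF assms(1,2) A'(1) A(1) chi[symmetric] eta[symmetric]]
    by (rule double_coset_subset[OF assms(1,2) A'(1)])
  ultimately show ?thesis using A A' by simp
qed

end
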